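(* For every $\varepsilon\in(0,\varepsilon^*]$, the discrete dynamical system $S_\varepsilon(n):B_{r^*}\to B_{r^*}$, $n\in\mathbb N$, generated by the implicit Euler scheme $u_n^\varepsilon=u_{n-1}^\varepsilon+\varepsilon Fu_n^\varepsilon$, has a unique numerical attractor, and it is given by $$\mathcal A_\varepsilon=\bigcap_{m\in\mathbb N}\overline{\bigcup_{n\ge m}S_\varepsilon(n)B_{r^*}}.$$
   Context: $\ell^2$ is the complex Hilbert space of square-summable sequences $u=(u_j)_{j\in\mathbb Z}$, $u_j\in\mathbb C$, with norm $\|\cdot\|$; $\|u\|_q^q=\sum_j|u_j|^q$. $\Lambda:\ell^2\to\ell^2$ is $(\Lambda u)_j=-u_{j-1}+2u_j-u_{j+1}$. Parameters: $\lambda,\gamma,k,p>0$, $\mu,\beta,\nu\in\mathbb R$, with $\gamma>4\lambda$; $g=(g_j)_{j\in\mathbb Z}$ is a fixed complex sequence with $\|g\|_{(p+2)/(p+1)}<\infty$ (hence $g\in\ell^2$). The vector field is $$Fu=(\lambda+i\mu)\Lambda u-(\gamma+i\beta)u-(k+i\nu)|u|^pu+g,\qquad |u|^pu=(|u_j|^pu_j)_{j\in\mathbb Z}.$$ $B_r=\{u\in\ell^2:\|u\|\le r\}$. $C_p>0$ is a constant depending only on $p$ such that $\||u|^pu-|v|^pv\|\le C_pr^p\|u-v\|$ for all $r>0$ and $u,v\in B_r$. For $r>0$, $M_r=(4\lambda+4|\mu|+\gamma+|\beta|)r+(k+|\nu|)r^{p+1}+\|g\|$ and $L_r=4\lambda+4|\mu|+\gamma+|\beta|+C_pr^p(k+|\nu|)$.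 Fix $\eta\ge0$ and set $$c_1=\frac{p+1}{p+2}\,\frac{1}{[k(p+2)]^{1/(p+1)}}\,\|g\|_{\frac{p+2}{p+1}}^{\frac{p+2}{p+1}},\quad r^*=\sqrt{\eta+\frac{c_1}{\gamma-4\lambda}},\quad \varepsilon^*=\min\Big\{\frac1{M_{r^*+1}},\frac1{1+L_{r^*+1}}\Big\}.$$ For $\varepsilon\in(0,\varepsilon^*]$ and $y\in B_{r^*}$ the scheme with $u_0^\varepsilon=y$ has a unique solution $u_n^\varepsilon(y)\in B_{r^*}$, $n\in\mathbb N$, and $S_\varepsilon(n)y:=u_n^\varepsilon(y)$. The Hausdorff semi-distance is $d_{\ell^2}(A,B)=\sup_{a\in A}\inf_{b\in B}\|a-b\|$. A numerical attractor is a compact set $\mathcal A_\varepsilon\subset B_{r^*}$ with $S_\varepsilon(n)\mathcal A_\varepsilon=\mathcal A_\varepsilon$ for all $n\in\mathbb N$ and $\lim_{n\to\infty}d_{\ell^2}(S_\varepsilon(n)B_{r^*},\mathcal A_\varepsilon)=0$. *)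

theory Defs
  imports "HOL-Analysis.Analysis"
begin

definition square_summable :: "(int \<Rightarrow> complex) \<Rightarrow> bool" where
  "square_summable u \<longleftrightarrow> (\<lambda>j. (cmod (u j))\<^sup>2) summable_on UNIV"

lemma L2_set_le_imp_square_summable:
  assumes "\<And>A. finite A \<Longrightarrow> L2_set (\<lambda>j. cmod (u j)) A \<le> C"
  shows "square_summable u" and "sqrt (\<Sum>\<^sub>\<infinity>j. (cmod (u j))\<^sup>2) \<le> C"
proof -
  have C0: "0 \<le> C" using assms[of "{}"] by simp
  have fin: "(\<Sum>j\<in>A. (cmod (u j))\<^sup>2) \<le> C\<^sup>2" if "finite A" for A
    using assms[OF that] C0 unfolding L2_set_def by (simp add: sqrt_le_D)
  show s: "square_summable u" unfolding square_summable_def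
    by (rule nonneg_bdd_above_summable_on) (auto intro!: bdd_aboveI2[where M = "C\<^sup>2"] fin)
  have "(\<Sum>\<^sub>\<infinity>j. (cmod (u j))\<^sup>2) \<le> C\<^sup>2"
    using s fin unfolding square_summable_def by (intro infsum_le_finite_sums) auto
  then show "sqrt (\<Sum>\<^sub>\<infinity>j. (cmod (u j))\<^sup>2) \<le> C"
    using C0 real_le_lsqrt by blast
qed

lemma L2_set_le_l2_norm:
  assumes "square_summable u" and "finite A"
  shows "L2_set (\<lambda>j. cmod (u j)) A \<le> sqrt (\<Sum>\<^sub>\<infinity>j. (cmod (u j))\<^sup>2)"
  unfolding L2_set_def using assms unfolding square_summable_def
  by (intro real_sqrt_le_mono finite_sum_le_infsum) auto

lemma square_summable_add_norm:
  assumes "square_summable u" "square_summable v"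
  shows "square_summable (\<lambda>j. u j + v j)"
    and "sqrt (\<Sum>\<^sub>\<infinity>j. (cmod (u j + v j))\<^sup>2)
       \<le> sqrt (\<Sum>\<^sub>\<infinity>j. (cmod (u j))\<^sup>2) + sqrt (\<Sum>\<^sub>\<infinity>j. (cmod (v j))\<^sup>2)"
proof -
  have "L2_set (\<lambda>j. cmod (u j + v j)) A
      \<le> sqrt (\<Sum>\<^sub>\<infinity>j. (cmod (u j))\<^sup>2) + sqrt (\<Sum>\<^sub>\<infinity>j. (cmod (v j))\<^sup>2)"
    if "finite A" for A
  proof -
    have "L2_set (\<lambda>j. cmod (u j + v j)) A \<le> L2_set (\<lambda>j. cmod (u j) + cmod (v j)) A"
      by (intro L2_set_mono norm_triangle_ineq) auto
    also have "\<dots> \<le> L2_set (\<lambda>j. cmod (u j)) A + L2_set (\<lambda>j. cmod (v j)) A"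
      by (rule L2_set_triangle_ineq)
    finally show ?thesis
      using L2_set_le_l2_norm[OF assms(1) that] L2_set_le_l2_norm[OF assms(2) that] by linarith
  qed
  note * = L2_set_le_imp_square_summable[OF this]
  show "square_summable (\<lambda>j. u j + v j)"
    and "sqrt (\<Sum>\<^sub>\<infinity>j. (cmod (u j + v j))\<^sup>2)
       \<le> sqrt (\<Sum>\<^sub>\<infinity>j. (cmod (u j))\<^sup>2) + sqrt (\<Sum>\<^sub>\<infinity>j. (cmod (v j))\<^sup>2)"
    by (rule *; assumption)+
qed

lemmas square_summable_add = square_summable_add_norm(1)

lemma square_summable_zero: "square_summable (\<lambda>j. 0)"
  by (simp add: square_summable_def)

lemma square_summable_cmult:
  "square_summable u \<Longrightarrow> square_summable (\<lambda>j. c * u j)"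
  unfolding square_summable_def
  by (simp add: norm_mult power_mult_distrib summable_on_cmult_right)

lemma square_summable_uminus:
  "square_summable u \<Longrightarrow> square_summable (\<lambda>j. - u j)"
  by (simp add: square_summable_def)

lemma square_summable_diff:
  "square_summable u \<Longrightarrow> square_summable v \<Longrightarrow> square_summable (\<lambda>j. u j - v j)"
  using square_summable_add[OF _ square_summable_uminus, of u v] by simp

lemma square_summable_shift:
  assumes "square_summable u" shows "square_summable (\<lambda>j. u (j + a))"
proof -
  have "bij_betw (\<lambda>j. j + a) (UNIV :: int set) UNIV"
    by (rule bij_betwI[where g = "\<lambda>j. j - a"]) auto
  from summable_on_reindex_bij_betw[OF this, of "\<lambda>j. (cmod (u j))\<^sup>2"] assms
  show ?thesis by (simp add: square_summable_def)
qed

typedef ell2 = "{u. square_summable u}"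
  morphisms coord ell2_of
  using square_summable_zero by blast

setup_lifting type_definition_ell2

instantiation ell2 :: real_normed_vector
begin

lift_definition zero_ell2 :: ell2 is "\<lambda>j. 0" by (rule square_summable_zero)

lift_definition plus_ell2 :: "ell2 \<Rightarrow> ell2 \<Rightarrow> ell2" is "\<lambda>u v j. u j + v j"
  by (rule square_summable_add)

lift_definition minus_ell2 :: "ell2 \<Rightarrow> ell2 \<Rightarrow> ell2" is "\<lambda>u v j. u j - v j"
  by (rule square_summable_diff)

lift_definition uminus_ell2 :: "ell2 \<Rightarrow> ell2" is "\<lambda>u j. - u j"
  by (rule square_summable_uminus)

lift_definition scaleR_ell2 :: "real \<Rightarrow> ell2 \<Rightarrow> ell2" is "\<lambda>a u j. of_real a * u j"
  by (rule square_summable_cmult)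

lift_definition norm_ell2 :: "ell2 \<Rightarrow> real" is "\<lambda>u. sqrt (\<Sum>\<^sub>\<infinity>j. (cmod (u j))\<^sup>2)" .

definition dist_ell2 :: "ell2 \<Rightarrow> ell2 \<Rightarrow> real" where
  "dist_ell2 u v = norm (u - v)"

definition sgn_ell2 :: "ell2 \<Rightarrow> ell2" where
  "sgn_ell2 u = inverse (norm u) *\<^sub>R u"

definition uniformity_ell2 :: "(ell2 \<times> ell2) filter" where
  "uniformity_ell2 = (INF e\<in>{0<..}. principal {(u, v). dist u v < e})"

definition open_ell2 :: "ell2 set \<Rightarrow> bool" where
  "open_ell2 U \<longleftrightarrow> (\<forall>u\<in>U. eventually (\<lambda>(u', v). u' = u \<longrightarrow> v \<in> U) uniformity)"

instance
proof
  fix u v w :: ell2 and a b :: real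
  show "u + v + w = u + (v + w)" by transfer (simp add: add.assoc)
  show "u + v = v + u" by transfer (simp add: add.commute)
  show "0 + u = u" by transfer simp
  show "- u + u = 0" by transfer simp
  show "u - v = u + - v" by transfer simp
  show "a *\<^sub>R (u + v) = a *\<^sub>R u + a *\<^sub>R v" by transfer (simp add: algebra_simps)
  show "(a + b) *\<^sub>R u = a *\<^sub>R u + b *\<^sub>R u" by transfer (simp add: algebra_simps)
  show "a *\<^sub>R b *\<^sub>R u = (a * b) *\<^sub>R u" by transfer (simp add: algebra_simps)
  show "1 *\<^sub>R u = u" by transfer simp
  show "dist u v = norm (u - v)" by (rule dist_ell2_def)
  show "sgn u = inverse (norm u) *\<^sub>R u" by (rule sgn_ell2_def)
  show "norm (u + v) \<le> norm u + norm v" by transfer (rule square_summable_add_norm(2))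
  show "norm (a *\<^sub>R u) = \<bar>a\<bar> * norm u"
    by transfer (simp add: norm_mult power_mult_distrib infsum_cmult_right' real_sqrt_mult)
  show "norm u = 0 \<longleftrightarrow> u = 0"
  proof transfer
    fix u :: "int \<Rightarrow> complex" assume u: "square_summable u"
    show "sqrt (\<Sum>\<^sub>\<infinity>j. (cmod (u j))\<^sup>2) = 0 \<longleftrightarrow> u = (\<lambda>j. 0)"
    proof
      assume "sqrt (\<Sum>\<^sub>\<infinity>j. (cmod (u j))\<^sup>2) = 0"
      then have "(\<Sum>\<^sub>\<infinity>j. (cmod (u j))\<^sup>2) \<le> 0" by simp
      then have "(cmod (u j))\<^sup>2 = 0" for j
        using u unfolding square_summable_def by (rule nonneg_infsum_le_0D) auto
      then show "u = (\<lambda>j. 0)" by auto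
    qed simp
  qed
next
  show "uniformity = (INF e\<in>{0<..}. principal {(u :: ell2, v). dist u v < e})"
    by (rule uniformity_ell2_def)
next
  fix U :: "ell2 set"
  show "open U \<longleftrightarrow> (\<forall>u\<in>U. \<forall>\<^sub>F (u', v) in uniformity. u' = u \<longrightarrow> v \<in> U)"
    by (rule open_ell2_def)
qed

end

lift_definition cscale :: "complex \<Rightarrow> ell2 \<Rightarrow> ell2" (infixr \<open>*\<^sub>c\<close> 75) is "\<lambda>c u j. c * u j"
  by (rule square_summable_cmult)

definition lq_summable :: "real \<Rightarrow> (int \<Rightarrow> complex) \<Rightarrow> bool" where
  "lq_summable q u \<longleftrightarrow> (\<lambda>j. cmod (u j) powr q) summable_on UNIV"

definition lq_norm_pow :: "real \<Rightarrow> (int \<Rightarrow> complex) \<Rightarrow> real" where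
  "lq_norm_pow q u = (\<Sum>\<^sub>\<infinity>j. cmod (u j) powr q)"

lift_definition Laplacian :: "ell2 \<Rightarrow> ell2" is "\<lambda>u j. - u (j - 1) + 2 * u j - u (j + 1)"
  using square_summable_shift[where a = "-1"] square_summable_shift[where a = 1]
  by (intro square_summable_diff square_summable_add square_summable_uminus square_summable_cmult)
     auto

text \<open>Only meaningful if the sequence on the right is square summable, which holds for
  \<^prop>\<open>0 < p\<close>; see \<open>coord_nonlin\<close>.\<close>

definition nonlin :: "real \<Rightarrow> ell2 \<Rightarrow> ell2" where
  "nonlin p u = ell2_of (\<lambda>j. of_real (cmod (coord u j) powr p) * coord u j)"

lemma cmod_coord_le_norm: "cmod (coord u j) \<le> norm u"
proof transfer
  fix u :: "int \<Rightarrow> complex" and j assume "square_summable u"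
  then show "cmod (u j) \<le> sqrt (\<Sum>\<^sub>\<infinity>j. (cmod (u j))\<^sup>2)"
    using L2_set_le_l2_norm[of u "{j}"] by simp
qed

lemma coord_nonlin:
  assumes "0 < p"
  shows "coord (nonlin p u) j = of_real (cmod (coord u j) powr p) * coord u j"
proof -
  have "square_summable (\<lambda>j. of_real (norm u powr p) * coord u j)"
    using coord by (intro square_summable_cmult) auto
  then have "square_summable (\<lambda>j. of_real (cmod (coord u j) powr p) * coord u j)"
    unfolding square_summable_def
    by (rule summable_on_comparison_test)
       (auto simp: norm_mult cmod_coord_le_norm
         intro!: power_mono mult_right_mono powr_mono2 less_imp_le[OF assms])
  then show ?thesis by (simp add: nonlin_def ell2_of_inverse)
qed

text \<open>The forcing \<open>g\<close> is a bare sequence; \<^term>\<open>ell2_of g\<close> is meaningful under the summability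
  hypothesis of \<open>coord_ell2_of_lq\<close>.\<close>

lemma coord_ell2_of_lq:
  assumes q: "0 < q" "q \<le> 2" and g: "lq_summable q g"
  shows "coord (ell2_of g) = g"
proof -
  define S where "S = lq_norm_pow q g"
  have le: "cmod (g j) powr q \<le> S" for j
    using finite_sum_le_infsum[OF g[unfolded lq_summable_def], of "{j}"]
    by (simp add: S_def lq_norm_pow_def)
  have S0: "0 \<le> S" unfolding S_def lq_norm_pow_def by (intro infsum_nonneg) auto
  have bound: "(cmod (g j))\<^sup>2 \<le> S powr ((2 - q) / q) * cmod (g j) powr q" for j
  proof (cases "g j = 0")
    case False
    then have "(cmod (g j))\<^sup>2 = cmod (g j) powr ((2 - q) + q)"
      by (simp add: powr_numeral)
    also have "\<dots> = (cmod (g j) powr q) powr ((2 - q) / q) * cmod (g j) powr q"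
      using q by (subst powr_add) (simp add: powr_powr)
    also have "\<dots> \<le> S powr ((2 - q) / q) * cmod (g j) powr q"
      using q le by (intro mult_right_mono powr_mono2) auto
    finally show ?thesis .
  qed simp
  have "(\<lambda>j. S powr ((2 - q) / q) * cmod (g j) powr q) summable_on UNIV"
    using g unfolding lq_summable_def by (rule summable_on_cmult_right)
  then have "square_summable g" unfolding square_summable_def
    by (rule summable_on_comparison_test) (auto simp: bound)
  then show ?thesis by (simp add: ell2_of_inverse)
qed

definition vector_field ::
  "real \<Rightarrow> real \<Rightarrow> real \<Rightarrow> real \<Rightarrow> real \<Rightarrow> real \<Rightarrow> real \<Rightarrow> (int \<Rightarrow> complex) \<Rightarrow> ell2 \<Rightarrow> ell2" where
  "vector_field lam \<mu> \<gamma> \<beta> k \<nu> p g u =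
     Complex lam \<mu> *\<^sub>c Laplacian u - Complex \<gamma> \<beta> *\<^sub>c u - Complex k \<nu> *\<^sub>c nonlin p u + ell2_of g"

definition field_bound ::
  "real \<Rightarrow> real \<Rightarrow> real \<Rightarrow> real \<Rightarrow> real \<Rightarrow> real \<Rightarrow> real \<Rightarrow> (int \<Rightarrow> complex) \<Rightarrow> real \<Rightarrow> real" where
  "field_bound lam \<mu> \<gamma> \<beta> k \<nu> p g r =
     (4 * lam + 4 * \<bar>\<mu>\<bar> + \<gamma> + \<bar>\<beta>\<bar>) * r + (k + \<bar>\<nu>\<bar>) * r powr (p + 1) + norm (ell2_of g)"

definition field_lipschitz ::
  "real \<Rightarrow> real \<Rightarrow> real \<Rightarrow> real \<Rightarrow> real \<Rightarrow> real \<Rightarrow> real \<Rightarrow> real \<Rightarrow> real \<Rightarrow> real" where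
  "field_lipschitz lam \<mu> \<gamma> \<beta> k \<nu> p C r =
     4 * lam + 4 * \<bar>\<mu>\<bar> + \<gamma> + \<bar>\<beta>\<bar> + C * r powr p * (k + \<bar>\<nu>\<bar>)"

definition c1_const :: "real \<Rightarrow> real \<Rightarrow> (int \<Rightarrow> complex) \<Rightarrow> real" where
  "c1_const k p g =
     (p + 1) / (p + 2) * (1 / (k * (p + 2)) powr (1 / (p + 1))) * lq_norm_pow ((p + 2) / (p + 1)) g"

definition r_star :: "real \<Rightarrow> real \<Rightarrow> real \<Rightarrow> real \<Rightarrow> real \<Rightarrow> (int \<Rightarrow> complex) \<Rightarrow> real" where
  "r_star \<eta> lam \<gamma> k p g = sqrt (\<eta> + c1_const k p g / (\<gamma> - 4 * lam))"

definition eps_star ::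
  "real \<Rightarrow> real \<Rightarrow> real \<Rightarrow> real \<Rightarrow> real \<Rightarrow> real \<Rightarrow> real \<Rightarrow> real \<Rightarrow> real \<Rightarrow> (int \<Rightarrow> complex) \<Rightarrow> real" where
  "eps_star \<eta> C lam \<mu> \<gamma> \<beta> k \<nu> p g =
     (let R = r_star \<eta> lam \<gamma> k p g + 1
      in min (1 / field_bound lam \<mu> \<gamma> \<beta> k \<nu> p g R)
             (1 / (1 + field_lipschitz lam \<mu> \<gamma> \<beta> k \<nu> p C R)))"

definition euler_solution :: "(ell2 \<Rightarrow> ell2) \<Rightarrow> real \<Rightarrow> ell2 set \<Rightarrow> ell2 \<Rightarrow> (nat \<Rightarrow> ell2) \<Rightarrow> bool" where
  "euler_solution F \<epsilon> B y u \<longleftrightarrow>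
     u 0 = y \<and> (\<forall>n. u n \<in> B) \<and> (\<forall>n\<ge>1. u n = u (n - 1) + \<epsilon> *\<^sub>R F (u n))"

definition euler_flow :: "(ell2 \<Rightarrow> ell2) \<Rightarrow> real \<Rightarrow> ell2 set \<Rightarrow> nat \<Rightarrow> ell2 \<Rightarrow> ell2" where
  "euler_flow F \<epsilon> B n y = (THE u. euler_solution F \<epsilon> B y u) n"

text \<open>Taken in \<^typ>\<open>ennreal\<close>, so that the distance from a nonempty set to the empty set is
  infinite; with real-valued \<^const>\<open>infdist\<close> it would be zero, and the empty set would pass for
  an attractor.\<close>

definition hausdorff_semidist :: "'a::metric_space set \<Rightarrow> 'a set \<Rightarrow> ennreal" where
  "hausdorff_semidist A B = (SUP a\<in>A. INF b\<in>B. ennreal (dist a b))"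

definition numerical_attractor ::
  "(nat \<Rightarrow> 'a \<Rightarrow> 'a) \<Rightarrow> 'a::metric_space set \<Rightarrow> 'a set \<Rightarrow> bool" where
  "numerical_attractor S B A \<longleftrightarrow>
     compact A \<and> A \<subseteq> B \<and> (\<forall>n. S n ` A = A) \<and>
     (\<lambda>n. hausdorff_semidist (S n ` B) A) \<longlonglongrightarrow> 0"

end

theory Submission
  imports Defs
begin

text \<open>
The attractor exists because the scheme is dissipative and asymptotically compact.

Dissipativity: since \<open>0 \<le> \<Lambda> \<le> 4\<close> and \<open>\<gamma> > 4 \<lambda>\<close>, taking the real inner product
of the implicit step \<open>u = v + \<epsilon> F u\<close> with \<open>u\<close> gives
\<open>(1 + 2 \<epsilon> (\<gamma> - 4 \<lambda>)) \<parallel>u\<parallel>\<^sup>2 \<le> \<parallel>v\<parallel>\<^sup>2 + 2 \<epsilon> c\<^sub>1\<close>, where the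
nonlinear term has absorbed the forcing by Young's inequality. Hence any
solution of a step that starts in the ball of radius \<open>r\<^sup>*\<close> stays there. The bounds in \<open>\<epsilon>\<^sup>*\<close>
make the step a contraction on a ball of radius \<open>r\<^sup>* + 1\<close>, so the scheme defines a Lipschitz
map on the ball of radius \<open>r\<^sup>*\<close> (\<open>euler_step_absorbing\<close>, \<open>implicit_step_contraction\<close>).

Asymptotic compactness: the ball is not compact, but the same inner product, weighted by a cutoff
that vanishes near the origin and varies slowly, shows that the energy carried by far away sites
satisfies the same contractive recursion with a source term that tends to zero as the cutoff moves
outwards. So the tails of \<open>S (n k) (y k)\<close> become uniformly small as \<open>n k\<close> tends to infinity, and a
coordinatewise convergent subsequence converges in norm (\<open>weighted_energy_step\<close>,
\<open>uniformly_small_tails\<close>, \<open>small_tails_convergent_subseq\<close>).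

For an asymptotically compact discrete semigroup on a closed set, the \<open>\<omega>\<close>-limit set is the
unique attractor (\<open>omega_limit_numerical_attractor\<close>).\<close>

section \<open>Attractors as omega-limit sets\<close>

lemma hausdorff_semidist_lessD:
  fixes A B :: "'a::metric_space set"
  assumes "hausdorff_semidist A B < ennreal e" and "a \<in> A"
  obtains b where "b \<in> B" and "dist a b < e"
proof -
  have "(INF b\<in>B. ennreal (dist a b)) < ennreal e"
    using assms unfolding hausdorff_semidist_def by (meson SUP_upper le_less_trans)
  then obtain b where "b \<in> B" "ennreal (dist a b) < ennreal e"
    by (auto simp: INF_less_iff)
  then show thesis
    using that by (auto simp: ennreal_less_iff)
qed

lemma hausdorff_semidist_le:
  fixes A B :: "'a::metric_space set"
  assumes "\<And>a. a \<in> A \<Longrightarrow> \<exists>b\<in>B. dist a b \<le> e"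
  shows "hausdorff_semidist A B \<le> ennreal e"
  unfolding hausdorff_semidist_def
proof (rule SUP_least)
  fix a assume "a \<in> A"
  then obtain b where "b \<in> B" "dist a b \<le> e" using assms by blast
  then show "(INF b\<in>B. ennreal (dist a b)) \<le> ennreal e"
    by (meson INF_lower ennreal_leI order_trans)
qed

lemma inverse_real_Suc_pos: "0 < inverse (real (Suc k))" by simp

lemma omega_limit_approx:
  fixes S :: "nat \<Rightarrow> 'a \<Rightarrow> 'a::metric_space"
  assumes "x \<in> (\<Inter>m. closure (\<Union>n\<in>{m..}. S n ` B))"
  shows "\<exists>n y. n \<ge> k \<and> y \<in> B \<and> dist (S n y) x < inverse (real (Suc k))"
proof -
  have "x \<in> closure (\<Union>n\<in>{k..}. S n ` B)" using assms by blast
  then obtain z where "z \<in> (\<Union>n\<in>{k..}. S n ` B)" "dist z x < inverse (real (Suc k))"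
    unfolding closure_approachable by (metis inverse_real_Suc_pos)
  then show ?thesis by auto
qed

text \<open>The sequential description makes asymptotic compactness applicable to the \<open>\<omega>\<close>-limit set.\<close>

lemma mem_omega_limit_iff:
  fixes S :: "nat \<Rightarrow> 'a \<Rightarrow> 'a::metric_space"
  shows "x \<in> (\<Inter>m. closure (\<Union>n\<in>{m..}. S n ` B)) \<longleftrightarrow>
    (\<exists>n y. filterlim n at_top sequentially \<and> (\<forall>k::nat. y k \<in> B) \<and> (\<lambda>k. S (n k) (y k)) \<longlonglongrightarrow> x)"
    (is "?L \<longleftrightarrow> ?R")
proof
  assume ?L
  then have "\<exists>n y. n \<ge> k \<and> y \<in> B \<and> dist (S n y) x < inverse (real (Suc k))" for k
    by (rule omega_limit_approx)
  then obtain n y where ny: "\<And>k. n k \<ge> k" "\<And>k. y k \<in> B"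
      "\<And>k. dist (S (n k) (y k)) x < inverse (real (Suc k))"
    by metis
  have "filterlim n at_top sequentially"
    using ny(1) by (intro filterlim_at_top_mono[OF filterlim_ident] always_eventually allI)
  moreover have "(\<lambda>k. S (n k) (y k)) \<longlonglongrightarrow> x"
  proof (rule metric_tendsto_imp_tendsto[OF LIMSEQ_inverse_real_of_nat], rule always_eventually, rule allI)
    fix k
    show "dist (S (n k) (y k)) x \<le> dist (inverse (real (Suc k))) 0"
      using ny(3)[of k] inverse_real_Suc_pos[of k] by (simp only: dist_norm diff_0_right real_norm_def)
  qed
  ultimately show ?R using ny(2) by blast
next
  assume ?R
  then obtain n y where n: "filterlim n at_top sequentially" and y: "\<And>k::nat. y k \<in> B"
    and lim: "(\<lambda>k. S (n k) (y k)) \<longlonglongrightarrow> x" by blast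
  show ?L
  proof
    fix m
    have "eventually (\<lambda>k. m \<le> n k) sequentially" using n by (simp add: filterlim_at_top)
    then have "eventually (\<lambda>k. S (n k) (y k) \<in> closure (\<Union>n\<in>{m..}. S n ` B)) sequentially"
    proof (rule eventually_mono)
      fix k assume "m \<le> n k"
      then have "S (n k) (y k) \<in> (\<Union>n\<in>{m..}. S n ` B)" using y by auto
      then show "S (n k) (y k) \<in> closure (\<Union>n\<in>{m..}. S n ` B)"
        using closure_subset by (rule rev_subsetD)
    qed
    then show "x \<in> closure (\<Union>n\<in>{m..}. S n ` B)"
      by (rule Lim_in_closed_set[OF closed_closure _ sequentially_bot lim])
  qed
qed

text \<open>The \<open>\<omega>\<close>-limit set consists of the limits of orbit sequences \<open>S (n k) (y k)\<close> with times
\<open>n k\<close> tending to infinity. The hypothesis that every such orbit sequence has a convergent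
subsequence replaces compactness of \<open>B\<close>, and each property follows by extracting one.
A sequence in \<open>\<omega>\<close> is shadowed by an orbit sequence, which gives compactness; shifting the times
by one in either direction gives the two inclusions of invariance; orbit points that stay away from
\<open>\<omega>\<close> at arbitrarily late times would accumulate at a point of \<open>\<omega>\<close>, which gives attraction.
Any attractor \<open>A\<close> equals \<open>\<omega>\<close>: invariance puts \<open>A\<close> inside every \<open>S n ` B\<close>, hence inside \<open>\<omega>\<close>,
and attraction puts every limit of an orbit sequence into the closed set \<open>A\<close>.\<close>

theorem omega_limit_numerical_attractor:
  fixes S :: "nat \<Rightarrow> 'a \<Rightarrow> 'a::metric_space" and B :: "'a set"
  defines "\<omega> \<equiv> \<Inter>m. closure (\<Union>n\<in>{m..}. S n ` B)"
  assumes B: "closed B"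
    and S_in: "\<And>n y. y \<in> B \<Longrightarrow> S n y \<in> B"
    and S_0: "\<And>y. y \<in> B \<Longrightarrow> S 0 y = y"
    and S_Suc: "\<And>n y. y \<in> B \<Longrightarrow> S (Suc n) y = S 1 (S n y)"
    and cont: "continuous_on B (S 1)"
    and compact: "\<And>n y. filterlim n at_top sequentially \<Longrightarrow> (\<And>k::nat. y k \<in> B) \<Longrightarrow>
      \<exists>l r. strict_mono r \<and> (\<lambda>k. S (n (r k)) (y (r k))) \<longlonglongrightarrow> l"
  shows "numerical_attractor S B \<omega>" and "\<And>A. numerical_attractor S B A \<Longrightarrow> A = \<omega>"
proof -
  note mem_\<omega> = mem_omega_limit_iff[of _ S B, folded \<omega>_def]
  have mem_\<omega>I: "x \<in> \<omega>" if "filterlim n at_top sequentially" "\<And>k::nat. y k \<in> B"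
      "(\<lambda>k. S (n k) (y k)) \<longlonglongrightarrow> x" for x n y
    unfolding mem_\<omega> using that by (intro exI[of _ n] exI[of _ y] conjI allI)
  \<comment> \<open>A subsequential limit of an orbit sequence is itself the limit of an orbit sequence, so asymptotic
    compactness yields limits inside \<open>\<omega>\<close>.\<close>
  have sub_lim: "\<exists>l\<in>\<omega>. \<exists>r. strict_mono r \<and> (\<lambda>k. S (n (r k)) (y (r k))) \<longlonglongrightarrow> l"
    if n: "filterlim n at_top sequentially" and y: "\<And>k::nat. y k \<in> B" for n y
  proof -
    obtain l r where r: "strict_mono r" and l: "(\<lambda>k. S (n (r k)) (y (r k))) \<longlonglongrightarrow> l"
      using compact[of n y, OF n y] by blast
    have "filterlim (\<lambda>k. n (r k)) at_top sequentially"
      by (rule filterlim_compose[OF n filterlim_subseq[OF r]])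
    then have "l \<in> \<omega>" using y l by (rule mem_\<omega>I)
    then show ?thesis using r l by blast
  qed
  have closed_\<omega>: "closed \<omega>" unfolding \<omega>_def by (intro closed_INT ballI closed_closure)
  have \<omega>_B: "\<omega> \<subseteq> B"
  proof -
    have "\<omega> \<subseteq> closure (\<Union>n\<in>{0..}. S n ` B)" unfolding \<omega>_def by (rule INF_lower) simp
    also have "\<dots> \<subseteq> B" by (rule closure_minimal[OF _ B]) (use S_in in blast)
    finally show ?thesis .
  qed
  have "compact \<omega>"
    unfolding compact_eq_seq_compact_metric
  proof (rule seq_compactI)
    fix x :: "nat \<Rightarrow> 'a" assume x: "\<forall>k. x k \<in> \<omega>"
    have "\<exists>n y. n \<ge> k \<and> y \<in> B \<and> dist (S n y) (x k) < inverse (real (Suc k))" for k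
      using x[rule_format, of k] unfolding \<omega>_def by (rule omega_limit_approx)
    then obtain n y where ny: "\<And>k. n k \<ge> k" "\<And>k. y k \<in> B"
        "\<And>k. dist (S (n k) (y k)) (x k) < inverse (real (Suc k))"
      by metis
    have "filterlim n at_top sequentially"
      using ny(1) by (intro filterlim_at_top_mono[OF filterlim_ident] always_eventually allI)
    from sub_lim[of n y, OF this ny(2)] obtain l r where l: "l \<in> \<omega>" "strict_mono r"
      "(\<lambda>k. S (n (r k)) (y (r k))) \<longlonglongrightarrow> l" by blast
    have "(\<lambda>k. dist (S (n k) (y k)) (x k)) \<longlonglongrightarrow> 0"
    proof (rule tendsto_sandwich[OF _ _ tendsto_const LIMSEQ_inverse_real_of_nat];
           rule always_eventually; rule allI)
      fix k
      show "dist (S (n k) (y k)) (x k) \<le> inverse (real (Suc k))"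
        using ny(3)[of k] by (rule less_imp_le)
    qed simp
    then have d: "(\<lambda>k. dist (S (n (r k)) (y (r k))) (x (r k))) \<longlonglongrightarrow> 0"
      by (rule LIMSEQ_subseq_LIMSEQ[OF _ l(2), unfolded o_def])
    have "(\<lambda>k. dist (S (n (r k)) (y (r k))) (x (r k)) + dist (S (n (r k)) (y (r k))) l) \<longlonglongrightarrow> 0 + 0"
      using l(3) by (intro tendsto_add d) (simp add: tendsto_dist_iff[symmetric])
    then have "(x \<circ> r) \<longlonglongrightarrow> l"
    proof (rule metric_tendsto_imp_tendsto, intro always_eventually allI)
      fix k
      show "dist ((x \<circ> r) k) l \<le>
          dist (dist (S (n (r k)) (y (r k))) (x (r k)) + dist (S (n (r k)) (y (r k))) l) (0 + 0)"
        using dist_triangle3[of "x (r k)" l "S (n (r k)) (y (r k))"] by (simp add: dist_real_def)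
    qed
    then show "\<exists>l\<in>\<omega>. \<exists>r. strict_mono r \<and> (x \<circ> r) \<longlonglongrightarrow> l" using l by blast
  qed
  have S_tendsto: "(\<lambda>k. S 1 (z k)) \<longlonglongrightarrow> S 1 l"
    if "z \<longlonglongrightarrow> l" "\<And>k. z k \<in> B" for z l
  proof (rule continuous_on_tendsto_compose[OF cont that(1)])
    show "l \<in> B" using closed_sequentially[OF B _ that(1)] that(2) by blast
  qed (use that(2) in simp)
  have inv1: "S 1 ` \<omega> = \<omega>"
  proof
    show "S 1 ` \<omega> \<subseteq> \<omega>"
    proof
      fix z assume "z \<in> S 1 ` \<omega>"
      then obtain x where x: "x \<in> \<omega>" "z = S 1 x" by blast
      then obtain n y where n: "filterlim n at_top sequentially" and y: "\<And>k::nat. y k \<in> B"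
        and lim: "(\<lambda>k. S (n k) (y k)) \<longlonglongrightarrow> x" unfolding mem_\<omega> by blast
      have "(\<lambda>k. S (Suc (n k)) (y k)) \<longlonglongrightarrow> z"
        using S_tendsto[OF lim] S_in y x by (simp add: S_Suc)
      moreover have "filterlim (\<lambda>k. Suc (n k)) at_top sequentially"
        using filterlim_compose[OF filterlim_Suc n] .
      ultimately show "z \<in> \<omega>" using mem_\<omega>I[of "\<lambda>k. Suc (n k)" y z] y by simp
    qed
    show "\<omega> \<subseteq> S 1 ` \<omega>"
    proof
      fix x assume "x \<in> \<omega>"
      then obtain n y where n: "filterlim n at_top sequentially" and y: "\<And>k::nat. y k \<in> B"
        and lim: "(\<lambda>k. S (n k) (y k)) \<longlonglongrightarrow> x" unfolding mem_\<omega> by blast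
      \<comment> \<open>A preimage of \<open>x\<close> is a subsequential limit of the orbit points one step earlier; the
        truncated subtraction is harmless since \<open>n k \<ge> 1\<close> eventually.\<close>
      have n': "filterlim (\<lambda>k. n k - 1) at_top sequentially"
        by (rule filterlim_compose[OF filterlim_minus_const_nat_at_top n])
      obtain l r where l: "l \<in> \<omega>" "strict_mono r"
        "(\<lambda>k. S (n (r k) - 1) (y (r k))) \<longlonglongrightarrow> l" using sub_lim[of "\<lambda>k. n k - 1" y, OF n' y] by blast
      have "(\<lambda>k. S 1 (S (n (r k) - 1) (y (r k)))) \<longlonglongrightarrow> S 1 l"
        using S_tendsto[OF l(3)] S_in y by blast
      moreover have "eventually (\<lambda>k. S 1 (S (n (r k) - 1) (y (r k))) = S (n (r k)) (y (r k))) sequentially"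
      proof -
        have "filterlim (\<lambda>k. n (r k)) at_top sequentially"
          by (rule filterlim_compose[OF n filterlim_subseq[OF l(2)]])
        then have "eventually (\<lambda>k. 1 \<le> n (r k)) sequentially" by (simp add: filterlim_at_top)
        then show ?thesis
        proof (rule eventually_mono)
          fix k assume "1 \<le> n (r k)"
          then show "S 1 (S (n (r k) - 1) (y (r k))) = S (n (r k)) (y (r k))"
            using S_Suc[OF y, of "n (r k) - 1" "r k"] by simp
        qed
      qed
      ultimately have "(\<lambda>k. S (n (r k)) (y (r k))) \<longlonglongrightarrow> S 1 l"
        by (rule Lim_transform_eventually)
      moreover have "(\<lambda>k. S (n (r k)) (y (r k))) \<longlonglongrightarrow> x"
        using LIMSEQ_subseq_LIMSEQ[OF lim l(2)] by (simp add: o_def)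
      ultimately show "x \<in> S 1 ` \<omega>" using l(1) LIMSEQ_unique by blast
    qed
  qed
  have inv: "S n ` \<omega> = \<omega>" for n
  proof (induction n)
    case 0
    have "S 0 ` \<omega> = id ` \<omega>" by (rule image_cong) (use S_0 \<omega>_B in auto)
    then show ?case by simp
  next
    case (Suc n)
    have "S (Suc n) ` \<omega> = S 1 ` S n ` \<omega>"
      unfolding image_image by (rule image_cong) (use S_Suc \<omega>_B in auto)
    then show ?case using Suc inv1 by simp
  qed
  have attr: "(\<lambda>n. hausdorff_semidist (S n ` B) \<omega>) \<longlonglongrightarrow> 0"
  proof (rule ccontr)
    assume "\<not> ?thesis"
    then obtain e where e: "0 < e" "\<not> eventually (\<lambda>n. hausdorff_semidist (S n ` B) \<omega> < e) sequentially"
      unfolding order_tendsto_iff using not_less_zero by blast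
    obtain d' where d': "0 < d'" "d' < e" using dense[OF e(1)] by blast
    obtain d where d: "0 < d" "ennreal d < e"
      using d' by (cases d' rule: ennreal_cases) auto
    have "\<exists>n\<ge>k. \<exists>y\<in>B. \<forall>b\<in>\<omega>. d < dist (S n y) b" for k
    proof (rule ccontr)
      assume near: "\<not> ?thesis"
      have "hausdorff_semidist (S n ` B) \<omega> \<le> ennreal d" if "n \<ge> k" for n
        
      proof (rule hausdorff_semidist_le)
        fix a assume "a \<in> S n ` B"
        then obtain y where "y \<in> B" "a = S n y" by blast
        then show "\<exists>b\<in>\<omega>. dist a b \<le> d"
          using near that not_less by blast
      qed
      then show False using e(2) d(2) unfolding eventually_sequentially
        by (meson le_less_trans)
    qed
    then obtain n y where ny: "\<And>k. n k \<ge> k" "\<And>k. y k \<in> B"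
        "\<And>k b. b \<in> \<omega> \<Longrightarrow> d < dist (S (n k) (y k)) b"
      by metis
    have "filterlim n at_top sequentially"
      using ny(1) by (intro filterlim_at_top_mono[OF filterlim_ident] always_eventually allI)
    from sub_lim[of n y, OF this ny(2)] obtain l r where l: "l \<in> \<omega>" "strict_mono r"
      "(\<lambda>k. S (n (r k)) (y (r k))) \<longlonglongrightarrow> l" by blast
    then have "eventually (\<lambda>k. dist (S (n (r k)) (y (r k))) l < d) sequentially"
      using d(1) by (simp add: tendsto_iff)
    then obtain k where "dist (S (n (r k)) (y (r k))) l < d"
      using eventually_happens'[OF sequentially_bot] by blast
    then show False using ny(3)[OF l(1), of "r k"] by simp
  qed
  show "numerical_attractor S B \<omega>"
    unfolding numerical_attractor_def using \<open>compact \<omega>\<close> \<omega>_B inv attr by blast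
  fix A assume "numerical_attractor S B A"
  then have A: "compact A" "A \<subseteq> B" "\<And>n. S n ` A = A"
    "(\<lambda>n. hausdorff_semidist (S n ` B) A) \<longlonglongrightarrow> 0"
    unfolding numerical_attractor_def by auto
  show "A = \<omega>"
  proof
    show "A \<subseteq> \<omega>"
    proof -
      have "A \<subseteq> (\<Union>n\<in>{m..}. S n ` B)" for m
      proof -
        have "A = S m ` A" using A(3) by simp
        also have "\<dots> \<subseteq> S m ` B" using A(2) by (rule image_mono)
        also have "\<dots> \<subseteq> (\<Union>n\<in>{m..}. S n ` B)" by (rule UN_upper) simp
        finally show ?thesis .
      qed
      then show ?thesis unfolding \<omega>_def by (intro INT_greatest) (rule order_trans[OF _ closure_subset])
    qed
    show "\<omega> \<subseteq> A"
    proof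
      fix x assume "x \<in> \<omega>"
      then obtain n y where n: "filterlim n at_top sequentially" and y: "\<And>k::nat. y k \<in> B"
        and lim: "(\<lambda>k. S (n k) (y k)) \<longlonglongrightarrow> x" unfolding mem_\<omega> by blast
      have "\<exists>a\<in>A. dist a x < e" if "0 < e" for e
      proof -
        have "eventually (\<lambda>n. hausdorff_semidist (S n ` B) A < ennreal (e/2)) sequentially"
          using order_tendstoD(2)[OF A(4)] \<open>0 < e\<close> by simp
        then have "eventually (\<lambda>k. hausdorff_semidist (S (n k) ` B) A < ennreal (e/2)) sequentially"
          by (rule eventually_compose_filterlim[OF _ n])
        moreover have "eventually (\<lambda>k. dist (S (n k) (y k)) x < e/2) sequentially"
          by (rule tendstoD[OF lim]) (use \<open>0 < e\<close> in simp)
        ultimately have "eventually (\<lambda>k. hausdorff_semidist (S (n k) ` B) A < ennreal (e/2) \<and>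
            dist (S (n k) (y k)) x < e/2) sequentially" by (rule eventually_conj)
        then obtain k where k: "hausdorff_semidist (S (n k) ` B) A < ennreal (e/2)"
            "dist (S (n k) (y k)) x < e/2"
          using eventually_happens'[OF sequentially_bot] by blast
        obtain a where "a \<in> A" "dist (S (n k) (y k)) a < e/2"
          using hausdorff_semidist_lessD[OF k(1)] y by blast
        then show ?thesis using k(2) dist_triangle_half_r by blast
      qed
      then show "x \<in> A"
        using closure_approachable[of x A] closure_closed[OF compact_imp_closed[OF A(1)]] by simp
    qed
  qed
qed

section \<open>Completeness and compactness in the sequence space\<close>

lemma square_summable_coord: "(\<lambda>j. (cmod (coord u j))\<^sup>2) summable_on A"
  using coord[of u] summable_on_subset_banach[of _ UNIV A]
  unfolding square_summable_def by auto

lemma norm_ell2_sq: "(norm u)\<^sup>2 = (\<Sum>\<^sub>\<infinity>j. (cmod (coord u j))\<^sup>2)"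
  unfolding norm_ell2.rep_eq by (simp add: infsum_nonneg)

lemma norm_ell2_le:
  assumes "0 \<le> c" and "\<And>j. cmod (coord u j) \<le> c * cmod (coord v j)"
  shows "norm u \<le> c * norm v"
proof (rule power2_le_imp_le)
  have "(norm u)\<^sup>2 \<le> (\<Sum>\<^sub>\<infinity>j. c\<^sup>2 * (cmod (coord v j))\<^sup>2)"
    unfolding norm_ell2_sq
    by (intro infsum_mono square_summable_coord summable_on_cmult_right)
       (metis assms(2) norm_ge_zero power_mono power_mult_distrib)
  then show "(norm u)\<^sup>2 \<le> (c * norm v)\<^sup>2"
    by (simp add: infsum_cmult_right' norm_ell2_sq power_mult_distrib)
qed (use assms in simp)

lemma norm_cscale: "norm (c *\<^sub>c u) \<le> cmod c * norm u"
  by (rule norm_ell2_le) (auto simp: cscale.rep_eq norm_mult)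

lemma norm_nonlin_le:
  assumes "0 < p" shows "norm (nonlin p u) \<le> norm u powr (p + 1)"
proof -
  have "norm (nonlin p u) \<le> norm u powr p * norm u"
    by (rule norm_ell2_le)
       (auto simp: coord_nonlin[OF assms] norm_mult cmod_coord_le_norm
         intro!: mult_right_mono powr_mono2 less_imp_le[OF assms])
  then show ?thesis by (simp add: powr_add)
qed

lemma summable_on_int_shift:
  fixes f :: "int \<Rightarrow> real"
  shows "(\<lambda>j. f (j + a)) summable_on UNIV \<longleftrightarrow> f summable_on UNIV"
    and "(\<Sum>\<^sub>\<infinity>j. f (j + a)) = (\<Sum>\<^sub>\<infinity>j. f j)"
proof -
  have bij: "bij_betw (\<lambda>j. j + a) (UNIV :: int set) UNIV"
    by (rule bij_betwI[where g = "\<lambda>j. j - a"]) auto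
  show "(\<lambda>j. f (j + a)) summable_on UNIV \<longleftrightarrow> f summable_on UNIV"
    by (rule summable_on_reindex_bij_betw[OF bij])
  show "(\<Sum>\<^sub>\<infinity>j. f (j + a)) = (\<Sum>\<^sub>\<infinity>j. f j)"
    by (rule infsum_reindex_bij_betw[OF bij])
qed

text \<open>The constant comes from the Cauchy--Schwarz inequality with weights \<open>1, 2, 1\<close>:
\<open>(x + 2 y + z)\<^sup>2 \<le> 4 (x\<^sup>2 + 2 y\<^sup>2 + z\<^sup>2)\<close>, summed over all sites.\<close>

lemma norm_Laplacian_le: "norm (Laplacian u) \<le> 4 * norm u"
proof (rule power2_le_imp_le)
  define a where "a j = (cmod (coord u j))\<^sup>2" for j
  have a: "a summable_on UNIV" unfolding a_def by (rule square_summable_coord)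
  have a_shift: "(\<lambda>j. a (j + i)) summable_on UNIV" for i
    using a by (simp add: summable_on_int_shift)
  have le: "(cmod (coord (Laplacian u) j))\<^sup>2 \<le> 4 * a (j + -1) + 8 * a j + 4 * a (j + 1)" for j
  proof -
    define x y z where "x = cmod (coord u (j-1))" and "y = cmod (coord u j)" and "z = cmod (coord u (j+1))"
    have "cmod (coord (Laplacian u) j) \<le> x + 2 * y + z"
      unfolding Laplacian.rep_eq x_def y_def z_def
      using norm_triangle_ineq4[of "- coord u (j-1) + 2 * coord u j" "coord u (j+1)"]
        norm_triangle_ineq[of "- coord u (j-1)" "2 * coord u j"]
      by (simp add: norm_mult)
    then have "(cmod (coord (Laplacian u) j))\<^sup>2 \<le> (x + 2 * y + z)\<^sup>2"
      by (intro power_mono) auto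
    also have "\<dots> \<le> 4 * x\<^sup>2 + 8 * y\<^sup>2 + 4 * z\<^sup>2"
    proof -
      have "0 \<le> 2 * (x - y)\<^sup>2 + 2 * (z - y)\<^sup>2 + (x - z)\<^sup>2" by simp
      also have "\<dots> = 4 * x\<^sup>2 + 8 * y\<^sup>2 + 4 * z\<^sup>2 - (x + 2 * y + z)\<^sup>2"
        by (simp add: power2_eq_square algebra_simps)
      finally show ?thesis by simp
    qed
    finally show ?thesis by (simp add: a_def x_def y_def z_def)
  qed
  have "(norm (Laplacian u))\<^sup>2 \<le> (\<Sum>\<^sub>\<infinity>j. 4 * a (j + -1) + 8 * a j + 4 * a (j + 1))"
    unfolding norm_ell2_sq
    by (intro infsum_mono square_summable_coord summable_on_add summable_on_cmult_right a a_shift le)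
  also have "\<dots> = 4 * (\<Sum>\<^sub>\<infinity>j. a (j + -1)) + 8 * (\<Sum>\<^sub>\<infinity>j. a j) + 4 * (\<Sum>\<^sub>\<infinity>j. a (j + 1))"
    by (simp add: infsum_add summable_on_add summable_on_cmult_right a a_shift infsum_cmult_right'
          a_shift[of "-1", simplified])
  also have "\<dots> = (4 * norm u)\<^sup>2"
    by (simp only: summable_on_int_shift(2)) (simp add: norm_ell2_sq a_def power_mult_distrib)
  finally show "(norm (Laplacian u))\<^sup>2 \<le> (4 * norm u)\<^sup>2" .
qed simp

text \<open>A Cauchy sequence has uniformly small finite partial norms of \<open>x m - x n\<close>; letting \<open>m\<close> tend to
infinity coordinatewise bounds the partial norms of \<open>l - x n\<close> by the same constant.\<close>

lemma coord_tendsto_Cauchy_imp_tendsto: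
  assumes "Cauchy x" and lim: "\<And>j. (\<lambda>n. coord (x n) j) \<longlonglongrightarrow> l j"
  shows "square_summable l" and "x \<longlonglongrightarrow> ell2_of l"
proof -
  have *: "\<exists>N. \<forall>n\<ge>N. square_summable (\<lambda>j. l j - coord (x n) j) \<and>
      sqrt (\<Sum>\<^sub>\<infinity>j. (cmod (l j - coord (x n) j))\<^sup>2) \<le> e" if "0 < e" for e
  proof -
    obtain N where N: "\<And>m n. m \<ge> N \<Longrightarrow> n \<ge> N \<Longrightarrow> norm (x m - x n) < e"
      using assms(1) \<open>0 < e\<close> unfolding Cauchy_iff by blast
    have "L2_set (\<lambda>j. cmod (l j - coord (x n) j)) A \<le> e" if "n \<ge> N" "finite A" for n A
    proof (rule LIMSEQ_le_const2)
      show "(\<lambda>m. L2_set (\<lambda>j. cmod (coord (x m) j - coord (x n) j)) A)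
          \<longlonglongrightarrow> L2_set (\<lambda>j. cmod (l j - coord (x n) j)) A"
        unfolding L2_set_def by (intro tendsto_intros lim)
      have "L2_set (\<lambda>j. cmod (coord (x m) j - coord (x n) j)) A \<le> e" if "m \<ge> N" for m
      proof -
        have "L2_set (\<lambda>j. cmod (coord (x m - x n) j)) A \<le> norm (x m - x n)"
          unfolding norm_ell2.rep_eq using L2_set_le_l2_norm[OF _ \<open>finite A\<close>] coord by blast
        then show ?thesis using N[OF that \<open>n \<ge> N\<close>] by (simp add: minus_ell2.rep_eq)
      qed
      then show "\<exists>N. \<forall>m\<ge>N. L2_set (\<lambda>j. cmod (coord (x m) j - coord (x n) j)) A \<le> e" by blast
    qed
    then have "square_summable (\<lambda>j. l j - coord (x n) j) \<and>
        sqrt (\<Sum>\<^sub>\<infinity>j. (cmod (l j - coord (x n) j))\<^sup>2) \<le> e" if "n \<ge> N" for n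
      using L2_set_le_imp_square_summable[of "\<lambda>j. l j - coord (x n) j" e] that by simp
    then show ?thesis by blast
  qed
  obtain N where "square_summable (\<lambda>j. l j - coord (x N) j)" using *[of 1] by auto
  then have "square_summable (\<lambda>j. (l j - coord (x N) j) + coord (x N) j)"
    using coord by (intro square_summable_add) auto
  then show l: "square_summable l" by simp
  have "norm (x n - ell2_of l) = sqrt (\<Sum>\<^sub>\<infinity>j. (cmod (l j - coord (x n) j))\<^sup>2)" for n
    using l by (simp add: norm_ell2.rep_eq minus_ell2.rep_eq ell2_of_inverse norm_minus_commute)
  then have le: "\<exists>N. \<forall>n\<ge>N. norm (x n - ell2_of l) \<le> e" if "0 < e" for e using *[OF that] by auto
  show "x \<longlonglongrightarrow> ell2_of l"
  proof (rule LIMSEQ_I)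
    fix e :: real assume "0 < e"
    then obtain N where "\<forall>n\<ge>N. norm (x n - ell2_of l) \<le> e / 2" using le[of "e / 2"] by auto
    then show "\<exists>N. \<forall>n\<ge>N. norm (x n - ell2_of l) < e"
      using \<open>0 < e\<close> by (intro exI[of _ N]) (smt (verit) field_sum_of_halves)
  qed
qed

instance ell2 :: banach
proof
  fix x :: "nat \<Rightarrow> ell2" assume x: "Cauchy x"
  have "convergent (\<lambda>n. coord (x n) j)" for j
  proof (rule Cauchy_convergent, rule CauchyI)
    fix e :: real assume "0 < e"
    then obtain N where N: "\<And>m n. m \<ge> N \<Longrightarrow> n \<ge> N \<Longrightarrow> norm (x m - x n) < e"
      using x unfolding Cauchy_iff by blast
    have "cmod (coord (x m) j - coord (x n) j) \<le> norm (x m - x n)" for m n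
      using cmod_coord_le_norm[of "x m - x n" j] by (simp add: minus_ell2.rep_eq)
    then show "\<exists>N. \<forall>m\<ge>N. \<forall>n\<ge>N. cmod (coord (x m) j - coord (x n) j) < e"
      using N le_less_trans by blast
  qed
  then have "\<exists>l. \<forall>j. (\<lambda>n. coord (x n) j) \<longlonglongrightarrow> l j" unfolding convergent_def by metis
  then show "convergent x" using coord_tendsto_Cauchy_imp_tendsto(2)[OF x] unfolding convergent_def by blast
qed

text \<open>The coordinates stay in a product of closed discs, which is compact by Tychonoff and sequentially
compact because the index set is countable.\<close>

lemma bounded_coord_convergent_subseq:
  fixes x :: "nat \<Rightarrow> ell2"
  assumes bdd: "\<And>n. norm (x n) \<le> M"
  obtains l r where "strict_mono r" and "\<And>j. (\<lambda>n. coord (x (r n)) j) \<longlonglongrightarrow> l j"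
proof -
  define K where "K = (UNIV :: int set) \<rightarrow>\<^sub>E cball (0::complex) M"
  have "compactin (product_topology (\<lambda>i::int. euclidean) UNIV) K"
    unfolding K_def compactin_PiE by simp
  then have "seq_compact K"
    by (simp add: euclidean_product_topology compact_imp_seq_compact)
  moreover have "\<forall>n. coord (x n) \<in> K"
    unfolding K_def using order_trans[OF cmod_coord_le_norm bdd] by auto
  ultimately obtain l r where r: "strict_mono r" and l: "((\<lambda>n. coord (x n)) \<circ> r) \<longlonglongrightarrow> l"
    unfolding seq_compact_def by metis
  have "(\<lambda>n. coord (x (r n)) j) \<longlonglongrightarrow> l j" for j
    using continuous_on_tendsto_compose[OF continuous_on_product_coordinates[of j] l]
    by (simp add: o_def)
  then show thesis using r that by blast
qed

text \<open>The compactness criterion of \<open>\<ell>\<^sup>2\<close>: along a coordinatewise convergent subsequence the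
finitely many coordinates in \<open>J\<close> converge uniformly, and the remaining ones contribute to
\<open>\<parallel>x (r m) - x (r n)\<parallel>\<^sup>2\<close> at most twice the sum of the two tails, so the subsequence is Cauchy.\<close>

lemma small_tails_convergent_subseq:
  fixes x :: "nat \<Rightarrow> ell2"
  assumes bdd: "\<And>n. norm (x n) \<le> M"
    and tails: "\<And>e. 0 < e \<Longrightarrow>
      \<exists>J. finite J \<and> eventually (\<lambda>n. (\<Sum>\<^sub>\<infinity>j\<in>-J. (cmod (coord (x n) j))\<^sup>2) \<le> e) sequentially"
  obtains l r where "strict_mono r" and "(\<lambda>n. x (r n)) \<longlonglongrightarrow> l"
proof -
  obtain l r where r: "strict_mono r" and l: "\<And>j. (\<lambda>n. coord (x (r n)) j) \<longlonglongrightarrow> l j"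
    using bounded_coord_convergent_subseq[of x M, OF bdd] by metis
  have split: "(norm u)\<^sup>2 = (\<Sum>j\<in>J. (cmod (coord u j))\<^sup>2) + (\<Sum>\<^sub>\<infinity>j\<in>-J. (cmod (coord u j))\<^sup>2)"
    if "finite J" for u :: ell2 and J
    using infsum_Un_disjoint[OF square_summable_coord[of u J] square_summable_coord[of u "-J"]] that
    by (simp add: norm_ell2_sq Compl_partition)
  have tail_diff: "(\<Sum>\<^sub>\<infinity>j\<in>A. (cmod (coord (u - v) j))\<^sup>2)
      \<le> 2 * (\<Sum>\<^sub>\<infinity>j\<in>A. (cmod (coord u j))\<^sup>2) + 2 * (\<Sum>\<^sub>\<infinity>j\<in>A. (cmod (coord v j))\<^sup>2)" for u v A
  proof -
    have "(cmod (coord (u - v) j))\<^sup>2 \<le> 2 * (cmod (coord u j))\<^sup>2 + 2 * (cmod (coord v j))\<^sup>2" for j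
    proof -
      have "(cmod (coord (u - v) j))\<^sup>2 \<le> (cmod (coord u j) + cmod (coord v j))\<^sup>2"
        by (intro power_mono) (auto simp: minus_ell2.rep_eq norm_triangle_ineq4)
      then show ?thesis
        using sum_squares_bound[of "cmod (coord u j)" "cmod (coord v j)"]
        by (simp add: power2_sum)
    qed
    then have "(\<Sum>\<^sub>\<infinity>j\<in>A. (cmod (coord (u - v) j))\<^sup>2)
        \<le> (\<Sum>\<^sub>\<infinity>j\<in>A. 2 * (cmod (coord u j))\<^sup>2 + 2 * (cmod (coord v j))\<^sup>2)"
      by (intro infsum_mono square_summable_coord summable_on_add summable_on_cmult_right)
    then show ?thesis
      by (simp add: infsum_add square_summable_coord summable_on_cmult_right infsum_cmult_right')
  qed
  have "Cauchy (\<lambda>n. x (r n))"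
  proof (rule CauchyI)
    fix e :: real assume "0 < e"
    obtain J where J: "finite J"
      and ev: "eventually (\<lambda>n. (\<Sum>\<^sub>\<infinity>j\<in>-J. (cmod (coord (x n) j))\<^sup>2) \<le> e\<^sup>2 / 8) sequentially"
      using tails[of "e\<^sup>2 / 8"] \<open>0 < e\<close> by auto
    have ev': "eventually (\<lambda>n. (\<Sum>\<^sub>\<infinity>j\<in>-J. (cmod (coord (x (r n)) j))\<^sup>2) \<le> e\<^sup>2 / 8) sequentially"
      by (rule eventually_compose_filterlim[OF ev filterlim_subseq[OF r]])
    have "(\<lambda>n. \<Sum>j\<in>J. (cmod (coord (x (r n)) j - l j))\<^sup>2) \<longlonglongrightarrow> (\<Sum>j\<in>J. (cmod (l j - l j))\<^sup>2)"
      by (intro tendsto_intros l)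
    then have "(\<lambda>n. \<Sum>j\<in>J. (cmod (coord (x (r n)) j - l j))\<^sup>2) \<longlonglongrightarrow> 0" by simp
    then have "eventually (\<lambda>n. (\<Sum>j\<in>J. (cmod (coord (x (r n)) j - l j))\<^sup>2) < e\<^sup>2 / 8) sequentially"
      by (rule order_tendstoD(2)) (use \<open>0 < e\<close> in simp)
    with ev' have "eventually (\<lambda>n. (\<Sum>\<^sub>\<infinity>j\<in>-J. (cmod (coord (x (r n)) j))\<^sup>2) \<le> e\<^sup>2 / 8 \<and>
        (\<Sum>j\<in>J. (cmod (coord (x (r n)) j - l j))\<^sup>2) < e\<^sup>2 / 8) sequentially"
      by (rule eventually_conj)
    then obtain N where N: "\<And>n. n \<ge> N \<Longrightarrow> (\<Sum>\<^sub>\<infinity>j\<in>-J. (cmod (coord (x (r n)) j))\<^sup>2) \<le> e\<^sup>2 / 8"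
        "\<And>n. n \<ge> N \<Longrightarrow> (\<Sum>j\<in>J. (cmod (coord (x (r n)) j - l j))\<^sup>2) < e\<^sup>2 / 8"
      unfolding eventually_sequentially by blast
    have "norm (x (r m) - x (r n)) < e" if "m \<ge> N" "n \<ge> N" for m n
    proof (rule power2_less_imp_less)
      have "(\<Sum>j\<in>J. (cmod (coord (x (r m) - x (r n)) j))\<^sup>2)
          \<le> (\<Sum>j\<in>J. 2 * (cmod (coord (x (r m)) j - l j))\<^sup>2 + 2 * (cmod (coord (x (r n)) j - l j))\<^sup>2)"
      proof (rule sum_mono)
        fix j
        define a b where "a = coord (x (r m)) j - l j" and "b = coord (x (r n)) j - l j"
        have "(cmod (a - b))\<^sup>2 \<le> (cmod a + cmod b)\<^sup>2"
          by (intro power_mono norm_triangle_ineq4) auto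
        then show "(cmod (coord (x (r m) - x (r n)) j))\<^sup>2 \<le>
            2 * (cmod (coord (x (r m)) j - l j))\<^sup>2 + 2 * (cmod (coord (x (r n)) j - l j))\<^sup>2"
          using sum_squares_bound[of "cmod a" "cmod b"]
          by (simp add: power2_sum a_def b_def minus_ell2.rep_eq)
      qed
      also have "\<dots> < e\<^sup>2 / 2"
        using N(2)[OF that(1)] N(2)[OF that(2)] by (simp add: sum.distrib flip: sum_distrib_left)
      finally show "(norm (x (r m) - x (r n)))\<^sup>2 < e\<^sup>2"
        using tail_diff[of "x (r m)" "x (r n)" "-J"] N(1)[OF that(1)] N(1)[OF that(2)] split[OF J, of "x (r m) - x (r n)"]
        by linarith
    qed (use \<open>0 < e\<close> in simp)
    then show "\<exists>N. \<forall>m\<ge>N. \<forall>n\<ge>N. norm (x (r m) - x (r n)) < e" by blast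
  qed
  then obtain l where "(\<lambda>n. x (r n)) \<longlonglongrightarrow> l" using Cauchy_convergent convergent_def by blast
  then show thesis using r that by blast
qed

section \<open>Lattice sums and pointwise inequalities\<close>

lemma has_sum_int_shift:
  fixes f :: "int \<Rightarrow> real"
  assumes "(f has_sum s) UNIV"
  shows "((\<lambda>j. f (j + a)) has_sum s) UNIV"
  using assms by (simp add: has_sum_iff summable_on_int_shift)

lemma has_sum_coord: "((\<lambda>j. (cmod (coord u j))\<^sup>2) has_sum (norm u)\<^sup>2) UNIV"
  by (simp add: has_sum_iff square_summable_coord norm_ell2_sq)

text \<open>Young's inequality for the exponents \<open>p + 2\<close> and \<open>(p + 2) / (p + 1)\<close>. The factor in front of
\<open>b powr ((p + 2) / (p + 1))\<close> is the one that occurs in \<^const>\<open>c1_const\<close>; it is the smallest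
possible, being attained at the maximum of \<open>b * x - k * x powr (p + 2)\<close>.\<close>

lemma Young_forcing:
  fixes k p b x :: real
  assumes k: "0 < k" and p: "0 < p" and b: "0 \<le> b" and x: "0 \<le> x"
  shows "b * x \<le> k * x powr (p + 2)
    + (p + 1) / (p + 2) * (1 / (k * (p + 2)) powr (1 / (p + 1))) * b powr ((p + 2) / (p + 1))"
proof -
  \<comment> \<open>Rescaling \<open>x\<close> by this factor turns the term \<open>x powr (p + 2) / (p + 2)\<close> of Young's inequality
    into \<open>k * x powr (p + 2)\<close>.\<close>
  define s where "s = (k * (p + 2)) powr (1 / (p + 2))"
  have kp: "0 < k * (p + 2)" using k p by simp
  then have s: "0 < s" unfolding s_def by (metis less_irrefl powr_gt_zero)
  have s_p: "s powr (p + 2) = k * (p + 2)"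
    unfolding s_def powr_powr using k p by simp
  have s_q: "s powr ((p + 2) / (p + 1)) = (k * (p + 2)) powr (1 / (p + 1))"
    unfolding s_def powr_powr using p by simp
  have "(s * x) * (b / s) \<le> (s * x) powr (p + 2) / (p + 2)
      + (b / s) powr ((p + 2) / (p + 1)) / ((p + 2) / (p + 1))"
    by (rule Youngs_inequality) (use p b x s in \<open>auto simp: field_simps\<close>)
  moreover have "(s * x) * (b / s) = b * x" using s by simp
  moreover have "(s * x) powr (p + 2) / (p + 2) = k * x powr (p + 2)"
    using s x p by (simp add: powr_mult s_p)
  moreover have "(b / s) powr ((p + 2) / (p + 1)) / ((p + 2) / (p + 1)) =
      (p + 1) / (p + 2) * (1 / (k * (p + 2)) powr (1 / (p + 1))) * b powr ((p + 2) / (p + 1))"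
    using s b by (simp add: powr_divide s_q mult.commute)
  ultimately show ?thesis by simp
qed

text \<open>The contribution of one site \<open>u\<close> with neighbours \<open>v\<close> and \<open>w\<close>. The real part of the coefficient
is absorbed by squares, with total weight \<open>4 * l\<close>; the imaginary part has no sign, but produces a
difference of the current \<open>Im (cnj u * w)\<close> between consecutive bonds, which cancels up to
gradients of the weight when summed along the lattice.\<close>

lemma Re_cnj_Laplacian_le:
  fixes u v w :: complex
  assumes "0 \<le> l"
  shows "Re (cnj u * (Complex l m * (- v + 2 * u - w)))
    \<le> 3 * l * (cmod u)\<^sup>2 + l / 2 * ((cmod v)\<^sup>2 + (cmod w)\<^sup>2)
      + m * (Im (cnj u * w) - Im (cnj v * u))"
proof -
  have cross: "- Re (cnj a * b) \<le> ((cmod a)\<^sup>2 + (cmod b)\<^sup>2) / 2" for a b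
  proof -
    have "0 \<le> (Re a + Re b)\<^sup>2 + (Im a + Im b)\<^sup>2" by simp
    then show ?thesis unfolding cmod_power2 by (simp add: power2_eq_square algebra_simps)
  qed
  have "Re (cnj u * (Complex l m * (- v + 2 * u - w))) =
      l * (2 * (cmod u)\<^sup>2 - Re (cnj v * u) - Re (cnj u * w))
      + m * (Im (cnj u * w) - Im (cnj v * u))"
    unfolding cmod_power2 by (simp add: power2_eq_square algebra_simps)
  also have "\<dots> \<le> l * (2 * (cmod u)\<^sup>2 + ((cmod v)\<^sup>2 + (cmod u)\<^sup>2) / 2 + ((cmod u)\<^sup>2 + (cmod w)\<^sup>2) / 2)
      + m * (Im (cnj u * w) - Im (cnj v * u))"
  proof (intro add_right_mono mult_left_mono assms)
    show "2 * (cmod u)\<^sup>2 - Re (cnj v * u) - Re (cnj u * w)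
        \<le> 2 * (cmod u)\<^sup>2 + ((cmod v)\<^sup>2 + (cmod u)\<^sup>2) / 2 + ((cmod u)\<^sup>2 + (cmod w)\<^sup>2) / 2"
      using cross[of v u] cross[of u w] by linarith
  qed
  also have "\<dots> = 3 * l * (cmod u)\<^sup>2 + l / 2 * ((cmod v)\<^sup>2 + (cmod w)\<^sup>2)
      + m * (Im (cnj u * w) - Im (cnj v * u))"
    by (simp add: field_simps)
  finally show ?thesis .
qed

lemma abs_Im_cnj_mult_le: "\<bar>Im (cnj a * b)\<bar> \<le> ((cmod a)\<^sup>2 + (cmod b)\<^sup>2) / 2"
proof -
  have "\<bar>Im (cnj a * b)\<bar> \<le> cmod a * cmod b"
    using abs_Im_le_cmod[of "cnj a * b"] by (simp add: norm_mult)
  then show ?thesis using sum_squares_bound[of "cmod a" "cmod b"] by simp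
qed

lemma Re_cnj_mult_le: "Re (cnj a * b) \<le> ((cmod a)\<^sup>2 + (cmod b)\<^sup>2) / 2"
proof -
  have "Re (cnj a * b) \<le> cmod a * cmod b"
    using complex_Re_le_cmod[of "cnj a * b"] by (simp add: norm_mult)
  then show ?thesis using sum_squares_bound[of "cmod a" "cmod b"] by simp
qed

section \<open>The weighted energy estimate\<close>

locale dissipative_lattice =
  fixes lam \<mu> \<gamma> \<beta> k \<nu> p :: real and g :: "int \<Rightarrow> complex"
  assumes lam: "0 < lam" and k: "0 < k" and p: "0 < p" and gap: "4 * lam < \<gamma>"
    and g: "lq_summable ((p + 2) / (p + 1)) g"
begin

abbreviation F :: "ell2 \<Rightarrow> ell2" where
  "F \<equiv> vector_field lam \<mu> \<gamma> \<beta> k \<nu> p g"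

abbreviation forcing_weight :: real where
  "forcing_weight \<equiv> (p + 1) / (p + 2) * (1 / (k * (p + 2)) powr (1 / (p + 1)))"

abbreviation g_pow :: "int \<Rightarrow> real" where
  "g_pow j \<equiv> cmod (g j) powr ((p + 2) / (p + 1))"

lemma g_pow_summable: "g_pow summable_on UNIV"
  using g by (simp add: lq_summable_def)

lemma c1_nonneg: "0 \<le> c1_const k p g"
  unfolding c1_const_def lq_norm_pow_def using k p by (intro mult_nonneg_nonneg infsum_nonneg) auto

lemma coord_F:
  "coord (F u) j = Complex lam \<mu> * (- coord u (j - 1) + 2 * coord u j - coord u (j + 1))
    - Complex \<gamma> \<beta> * coord u j - Complex k \<nu> * (of_real (cmod (coord u j) powr p) * coord u j) + g j"
proof -
  have "(p + 2) / (p + 1) \<le> 2" "0 < (p + 2) / (p + 1)" using p by (auto simp: field_simps)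
  then have "coord (ell2_of g) j = g j" using coord_ell2_of_lq g by simp
  then show ?thesis
    unfolding vector_field_def
    by (simp add: plus_ell2.rep_eq minus_ell2.rep_eq cscale.rep_eq Laplacian.rep_eq coord_nonlin[OF p])
qed

text \<open>The dissipation at one site. The left neighbour is written \<open>j + -1\<close> so that the terms are
literally shifts in the sense of \<open>has_sum_int_shift\<close>; the last current is that of the bond on the
left, \<open>j + -1 + 1\<close> being \<open>j\<close>.\<close>

lemma Re_cnj_F_le:
  "Re (cnj (coord u j) * coord (F u) j)
    \<le> (3 * lam - \<gamma>) * (cmod (coord u j))\<^sup>2
      + lam / 2 * ((cmod (coord u (j + -1)))\<^sup>2 + (cmod (coord u (j + 1)))\<^sup>2)
      + \<mu> * (Im (cnj (coord u j) * coord u (j + 1)) - Im (cnj (coord u (j + -1)) * coord u (j + -1 + 1)))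
      + forcing_weight * g_pow j"
proof -
  define a where "a = coord u j"
  have damp: "Re (cnj a * (Complex \<gamma> \<beta> * a)) = \<gamma> * (cmod a)\<^sup>2"
    unfolding cmod_power2 by (simp add: power2_eq_square algebra_simps)
  have "cmod a powr (p + 2) = cmod a powr p * (cmod a)\<^sup>2"
    by (cases "a = 0") (simp_all add: powr_add powr_numeral)
  then have nonl: "Re (cnj a * (Complex k \<nu> * (of_real (cmod a powr p) * a))) = k * cmod a powr (p + 2)"
    unfolding cmod_power2 by (simp add: power2_eq_square algebra_simps)
  have "Re (cnj a * g j) \<le> cmod (g j) * cmod a"
    using complex_Re_le_cmod[of "cnj a * g j"] by (simp add: norm_mult mult.commute)
  also have "\<dots> \<le> k * cmod a powr (p + 2) + forcing_weight * g_pow j"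
    by (rule Young_forcing[OF k p]) auto
  finally have force: "Re (cnj a * g j) \<le> k * cmod a powr (p + 2) + forcing_weight * g_pow j" .
  have "cnj a * coord (F u) j = cnj a * (Complex lam \<mu> * (- coord u (j - 1) + 2 * a - coord u (j + 1)))
      - cnj a * (Complex \<gamma> \<beta> * a) - cnj a * (Complex k \<nu> * (of_real (cmod a powr p) * a)) + cnj a * g j"
    unfolding coord_F a_def[symmetric] by (simp only: distrib_left right_diff_distrib)
  then have "Re (cnj a * coord (F u) j) =
      Re (cnj a * (Complex lam \<mu> * (- coord u (j - 1) + 2 * a - coord u (j + 1))))
      - \<gamma> * (cmod a)\<^sup>2 - k * cmod a powr (p + 2) + Re (cnj a * g j)"
    by (simp only: plus_complex.sel minus_complex.sel damp nonl)
  then show ?thesis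
    using force Re_cnj_Laplacian_le[of lam a \<mu> "coord u (j - 1)" "coord u (j + 1)"] lam
    by (simp add: a_def left_diff_distrib)
qed

text \<open>Testing one implicit Euler step with the weighted solution. At each site the step gives
\<open>\<bar>u\<^sub>j\<bar>\<^sup>2 \<le> \<bar>v\<^sub>j\<bar>\<^sup>2 + 2 \<epsilon> Re (cnj u\<^sub>j (F u)\<^sub>j)\<close>. After multiplication by
\<open>\<theta> j\<close> the weights of the neighbouring terms are moved to their own site at the price of
\<open>\<kappa>\<close>, so that the shifted sums coincide with the unshifted ones and the current telescopes.
The constant weight with \<open>\<kappa> = 0\<close> yields the absorbing ball, slowly varying cutoff weights
yield the tail estimate.\<close>

lemma weighted_energy_step:
  fixes \<theta> :: "int \<Rightarrow> real"
  assumes \<theta>: "\<And>j. 0 \<le> \<theta> j" "\<And>j. \<theta> j \<le> 1" "\<And>j. \<bar>\<theta> (j + 1) - \<theta> j\<bar> \<le> \<kappa>"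
    and \<epsilon>: "0 < \<epsilon>" and step: "u = v + \<epsilon> *\<^sub>R F u"
  shows "(1 + 2 * \<epsilon> * (\<gamma> - 4 * lam)) * (\<Sum>\<^sub>\<infinity>j. \<theta> j * (cmod (coord u j))\<^sup>2)
    \<le> (\<Sum>\<^sub>\<infinity>j. \<theta> j * (cmod (coord v j))\<^sup>2)
      + 2 * \<epsilon> * (forcing_weight * (\<Sum>\<^sub>\<infinity>j. \<theta> j * g_pow j) + \<kappa> * (lam + \<bar>\<mu>\<bar>) * (norm u)\<^sup>2)"
proof -
  define a where "a j = (cmod (coord u j))\<^sup>2" for j
  define b where "b j = (cmod (coord v j))\<^sup>2" for j
  define I where "I j = Im (cnj (coord u j) * coord u (j + 1))" for j
  define A where "A j = \<theta> j * a j" for j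
  define T where "T j = \<theta> j * I j" for j
  have \<theta>_summable: "(\<lambda>j. \<theta> j * f j) summable_on UNIV" if "f summable_on UNIV" "\<And>j. 0 \<le> f j" for f
    by (rule summable_on_comparison_test[OF that(1)]) (use \<theta> that(2) in \<open>auto intro: mult_left_le_one_le\<close>)
  have a_sum: "(a has_sum (norm u)\<^sup>2) UNIV" unfolding a_def by (rule has_sum_coord)
  have A_sum: "(A has_sum infsum A UNIV) UNIV"
    unfolding A_def by (intro has_sum_infsum \<theta>_summable) (auto simp: a_def square_summable_coord)
  have b_sum: "((\<lambda>j. \<theta> j * b j) has_sum (\<Sum>\<^sub>\<infinity>j. \<theta> j * b j)) UNIV"
    by (intro has_sum_infsum \<theta>_summable) (auto simp: b_def square_summable_coord)
  have G_sum: "((\<lambda>j. \<theta> j * g_pow j) has_sum (\<Sum>\<^sub>\<infinity>j. \<theta> j * g_pow j)) UNIV"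
    by (intro has_sum_infsum \<theta>_summable g_pow_summable) auto
  have I_le: "\<bar>I j\<bar> \<le> (a j + a (j + 1)) / 2" for j
    unfolding I_def a_def by (rule abs_Im_cnj_mult_le)
  have "(\<lambda>j. 1/2 * (a j + a (j + 1))) summable_on UNIV"
    using has_sum_add[OF a_sum has_sum_int_shift[OF a_sum, of 1]]
    by (intro summable_on_cmult_right) (auto simp: summable_on_def)
  then have "(\<lambda>j. norm (T j)) summable_on UNIV"
  proof (rule summable_on_comparison_test)
    fix j
    have "\<bar>T j\<bar> \<le> 1 * \<bar>I j\<bar>" unfolding T_def abs_mult using \<theta> by (intro mult_right_mono) auto
    then show "norm (T j) \<le> 1/2 * (a j + a (j + 1))" using I_le[of j] by simp
  qed auto
  then have T_sum: "(T has_sum infsum T UNIV) UNIV"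
    by (intro has_sum_infsum) (rule summable_on_iff_abs_summable_on_real[THEN iffD2])
  have pointwise: "A j \<le> \<theta> j * b j + 2 * \<epsilon> *
      ((3 * lam - \<gamma>) * A j + lam / 2 * (A (j + -1) + A (j + 1)) + lam * \<kappa> / 2 * (a (j + -1) + a (j + 1))
       + \<mu> * (T j - T (j + -1)) + \<bar>\<mu>\<bar> * \<kappa> / 2 * (a (j + -1) + a j) + forcing_weight * (\<theta> j * g_pow j))"
    (is "_ \<le> _ + 2 * \<epsilon> * ?D") for j
  proof -
    define d where "d = (3 * lam - \<gamma>) * a j + lam / 2 * (a (j + -1) + a (j + 1))
      + \<mu> * (I j - I (j + -1)) + forcing_weight * g_pow j"
    have "a j = Re (cnj (coord u j) * coord u j)"
      unfolding a_def cmod_power2 by (simp add: power2_eq_square)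
    also have "\<dots> = Re (cnj (coord u j) * coord v j) + \<epsilon> * Re (cnj (coord u j) * coord (F u) j)"
    proof -
      have "coord u j = coord v j + of_real \<epsilon> * coord (F u) j"
        by (subst step) (simp add: plus_ell2.rep_eq scaleR_ell2.rep_eq)
      then have "cnj (coord u j) * coord u j
          = cnj (coord u j) * coord v j + of_real \<epsilon> * (cnj (coord u j) * coord (F u) j)"
        by (metis distrib_left mult.left_commute)
      then show ?thesis by simp
    qed
    also have "\<dots> \<le> (a j + b j) / 2 + \<epsilon> * d"
    proof (rule add_mono)
      show "Re (cnj (coord u j) * coord v j) \<le> (a j + b j) / 2"
        unfolding a_def b_def by (rule Re_cnj_mult_le)
      show "\<epsilon> * Re (cnj (coord u j) * coord (F u) j) \<le> \<epsilon> * d"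
        unfolding d_def a_def I_def using \<epsilon> by (intro mult_left_mono Re_cnj_F_le) auto
    qed
    finally have "a j \<le> b j + 2 * \<epsilon> * d" by (simp add: field_simps)
    then have "A j \<le> \<theta> j * (b j + 2 * \<epsilon> * d)"
      unfolding A_def using \<theta>(1) by (rule mult_left_mono)
    also have "\<dots> = \<theta> j * b j + 2 * \<epsilon> * (\<theta> j * d)" by (simp add: algebra_simps)
    also have "\<dots> \<le> \<theta> j * b j + 2 * \<epsilon> * ?D"
    proof -
      have \<theta>_down: "\<bar>\<theta> j - \<theta> (j + -1)\<bar> \<le> \<kappa>" using \<theta>(3)[of "j - 1"] by simp
      have \<theta>_up: "\<bar>\<theta> j - \<theta> (j + 1)\<bar> \<le> \<kappa>" using \<theta>(3)[of j] by (simp add: abs_minus_commute)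
      have a_nonneg: "0 \<le> a i" for i by (simp add: a_def)
      \<comment> \<open>Moving the weight to the neighbouring site costs \<open>\<kappa>\<close> times the unweighted energy there.\<close>
      have neighbour: "\<theta> j * a i \<le> A i + \<kappa> * a i" if "\<bar>\<theta> j - \<theta> i\<bar> \<le> \<kappa>" for i
      proof -
        have "(\<theta> j - \<theta> i) * a i \<le> \<kappa> * a i" using that a_nonneg by (intro mult_right_mono) auto
        then show ?thesis by (simp add: A_def algebra_simps)
      qed
      have "lam / 2 * (\<theta> j * a (j + -1) + \<theta> j * a (j + 1)) \<le>
          lam / 2 * (A (j + -1) + \<kappa> * a (j + -1) + (A (j + 1) + \<kappa> * a (j + 1)))"
        using lam by (intro mult_left_mono add_mono neighbour \<theta>_down \<theta>_up) auto
      moreover have "\<mu> * (\<theta> j * I j - \<theta> j * I (j + -1))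
          \<le> \<mu> * (T j - T (j + -1)) + \<bar>\<mu>\<bar> * \<kappa> / 2 * (a (j + -1) + a j)"
      proof -
        have "\<mu> * (\<theta> j * I j - \<theta> j * I (j + -1)) - \<mu> * (T j - T (j + -1))
            = - (\<mu> * ((\<theta> j - \<theta> (j + -1)) * I (j + -1)))"
          by (simp add: T_def algebra_simps)
        also have "\<dots> \<le> \<bar>\<mu>\<bar> * (\<bar>\<theta> j - \<theta> (j + -1)\<bar> * \<bar>I (j + -1)\<bar>)"
          using abs_ge_minus_self[of "\<mu> * ((\<theta> j - \<theta> (j + -1)) * I (j + -1))"] by (simp add: abs_mult)
        also have "\<dots> \<le> \<bar>\<mu>\<bar> * (\<kappa> * ((a (j + -1) + a j) / 2))"
        proof (intro mult_left_mono mult_mono)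
          show "\<bar>I (j + -1)\<bar> \<le> (a (j + -1) + a j) / 2" using I_le[of "j + -1"] by simp
          show "0 \<le> \<kappa>" using \<theta>_down by linarith
        qed (use \<theta>_down in auto)
        finally show ?thesis by (simp add: field_simps)
      qed
      ultimately have "\<theta> j * d \<le> ?D" unfolding d_def A_def by (simp add: algebra_simps)
      then show ?thesis using \<epsilon> by simp
    qed
    finally show ?thesis .
  qed
  have "infsum A UNIV \<le> (\<Sum>\<^sub>\<infinity>j. \<theta> j * b j) + 2 * \<epsilon> *
      ((3 * lam - \<gamma>) * infsum A UNIV + lam / 2 * (infsum A UNIV + infsum A UNIV)
       + lam * \<kappa> / 2 * ((norm u)\<^sup>2 + (norm u)\<^sup>2) + \<mu> * (infsum T UNIV - infsum T UNIV)
       + \<bar>\<mu>\<bar> * \<kappa> / 2 * ((norm u)\<^sup>2 + (norm u)\<^sup>2)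
       + forcing_weight * (\<Sum>\<^sub>\<infinity>j. \<theta> j * g_pow j))"
  proof (rule has_sum_mono[OF A_sum _ pointwise])
    have T_diff: "((\<lambda>j. T j - T (j + -1)) has_sum (infsum T UNIV - infsum T UNIV)) UNIV"
      using has_sum_add[OF T_sum has_sum_cmult_right[OF has_sum_int_shift[OF T_sum, of "-1"], of "-1"]]
      by simp
    show "((\<lambda>j. \<theta> j * b j + 2 * \<epsilon> *
      ((3 * lam - \<gamma>) * A j + lam / 2 * (A (j + -1) + A (j + 1)) + lam * \<kappa> / 2 * (a (j + -1) + a (j + 1))
       + \<mu> * (T j - T (j + -1)) + \<bar>\<mu>\<bar> * \<kappa> / 2 * (a (j + -1) + a j) + forcing_weight * (\<theta> j * g_pow j)))
      has_sum ((\<Sum>\<^sub>\<infinity>j. \<theta> j * b j) + 2 * \<epsilon> *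
      ((3 * lam - \<gamma>) * infsum A UNIV + lam / 2 * (infsum A UNIV + infsum A UNIV)
       + lam * \<kappa> / 2 * ((norm u)\<^sup>2 + (norm u)\<^sup>2) + \<mu> * (infsum T UNIV - infsum T UNIV)
       + \<bar>\<mu>\<bar> * \<kappa> / 2 * ((norm u)\<^sup>2 + (norm u)\<^sup>2)
       + forcing_weight * (\<Sum>\<^sub>\<infinity>j. \<theta> j * g_pow j)))) UNIV"
      by (intro has_sum_add has_sum_cmult_right has_sum_int_shift a_sum A_sum b_sum G_sum T_diff)
  qed
  then show ?thesis unfolding A_def a_def b_def by (simp add: algebra_simps)
qed

text \<open>The radius is chosen so that \<open>c\<^sub>1 \<le> (\<gamma> - 4 \<lambda>) r\<^sup>2\<close>, which makes the ball of this radius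
invariant under the energy recursion.\<close>

lemma euler_step_absorbing:
  assumes \<epsilon>: "0 < \<epsilon>" and \<eta>: "0 \<le> \<eta>" and step: "u = v + \<epsilon> *\<^sub>R F u"
    and v: "norm v \<le> r_star \<eta> lam \<gamma> k p g"
  shows "norm u \<le> r_star \<eta> lam \<gamma> k p g"
proof (rule power2_le_imp_le)
  define \<alpha> where "\<alpha> = \<gamma> - 4 * lam"
  define c where "c = c1_const k p g"
  have \<alpha>: "0 < \<alpha>" using gap by (simp add: \<alpha>_def)
  have r_sq: "(r_star \<eta> lam \<gamma> k p g)\<^sup>2 = \<eta> + c / \<alpha>"
    unfolding r_star_def \<alpha>_def[symmetric] c_def using \<eta> \<alpha> c1_nonneg by simp
  have "(1 + 2 * \<epsilon> * \<alpha>) * (norm u)\<^sup>2 \<le> (norm v)\<^sup>2 + 2 * \<epsilon> * c"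
    using weighted_energy_step[of "\<lambda>_. 1" 0 \<epsilon> u v] \<epsilon> step
    by (simp add: \<alpha>_def c_def c1_const_def lq_norm_pow_def norm_ell2_sq)
  also have "\<dots> \<le> (\<eta> + c / \<alpha>) + 2 * \<epsilon> * c"
    using power_mono[OF v, of 2] by (simp add: r_sq)
  also have "\<dots> \<le> (1 + 2 * \<epsilon> * \<alpha>) * (\<eta> + c / \<alpha>)"
    using \<epsilon> \<alpha> \<eta> by (simp add: field_simps)
  finally show "(norm u)\<^sup>2 \<le> (r_star \<eta> lam \<gamma> k p g)\<^sup>2"
    unfolding r_sq using \<epsilon> \<alpha> by (simp add: add_pos_pos)
  show "0 \<le> r_star \<eta> lam \<gamma> k p g"
    using v norm_ge_zero order_trans by blast
qed

lemma norm_Complex_cscale_le: "norm (Complex a b *\<^sub>c u) \<le> (\<bar>a\<bar> + \<bar>b\<bar>) * norm u"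
  using norm_cscale[of "Complex a b" u] mult_right_mono[OF cmod_le[of "Complex a b"] norm_ge_zero[of u]]
  by simp

lemma norm_F_le:
  assumes "norm u \<le> r"
  shows "norm (F u) \<le> field_bound lam \<mu> \<gamma> \<beta> k \<nu> p g r"
proof -
  have "norm (F u) \<le> norm (Complex lam \<mu> *\<^sub>c Laplacian u) + norm (Complex \<gamma> \<beta> *\<^sub>c u)
      + norm (Complex k \<nu> *\<^sub>c nonlin p u) + norm (ell2_of g)"
    unfolding vector_field_def
    by (intro order_trans[OF norm_triangle_ineq] add_right_mono order_trans[OF norm_triangle_ineq4]
        norm_triangle_ineq4)
  moreover have "norm (Complex lam \<mu> *\<^sub>c Laplacian u) \<le> (lam + \<bar>\<mu>\<bar>) * (4 * r)"
    using lam assms norm_Laplacian_le[of u]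
    by (intro order_trans[OF norm_Complex_cscale_le] mult_mono) auto
  moreover have "norm (Complex \<gamma> \<beta> *\<^sub>c u) \<le> (\<gamma> + \<bar>\<beta>\<bar>) * r"
    using lam gap assms by (intro order_trans[OF norm_Complex_cscale_le] mult_mono) auto
  moreover have "norm (Complex k \<nu> *\<^sub>c nonlin p u) \<le> (k + \<bar>\<nu>\<bar>) * r powr (p + 1)"
    using k p assms
    by (intro order_trans[OF norm_Complex_cscale_le] mult_mono order_trans[OF norm_nonlin_le] powr_mono2) auto
  ultimately show ?thesis unfolding field_bound_def by (simp add: algebra_simps)
qed

lemma norm_F_diff_le:
  assumes lip: "norm (nonlin p u - nonlin p v) \<le> C * r powr p * norm (u - v)"
  shows "norm (F u - F v) \<le> field_lipschitz lam \<mu> \<gamma> \<beta> k \<nu> p C r * norm (u - v)"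
proof -
  have cscale_diff: "c *\<^sub>c x - c *\<^sub>c y = c *\<^sub>c (x - y)" for c x y
    by transfer (simp add: algebra_simps)
  have Lap_diff: "Laplacian u - Laplacian v = Laplacian (u - v)"
    by transfer (simp add: algebra_simps)
  have "F u - F v = Complex lam \<mu> *\<^sub>c Laplacian (u - v) - Complex \<gamma> \<beta> *\<^sub>c (u - v)
      - Complex k \<nu> *\<^sub>c (nonlin p u - nonlin p v)"
    unfolding vector_field_def Lap_diff[symmetric] cscale_diff[symmetric] by simp
  then have "norm (F u - F v) \<le> norm (Complex lam \<mu> *\<^sub>c Laplacian (u - v)) + norm (Complex \<gamma> \<beta> *\<^sub>c (u - v))
      + norm (Complex k \<nu> *\<^sub>c (nonlin p u - nonlin p v))"
    by (auto intro: order_trans[OF norm_triangle_ineq4] add_right_mono norm_triangle_ineq4)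
  moreover have "norm (Complex lam \<mu> *\<^sub>c Laplacian (u - v)) \<le> (lam + \<bar>\<mu>\<bar>) * (4 * norm (u - v))"
    using lam norm_Laplacian_le[of "u - v"]
    by (intro order_trans[OF norm_Complex_cscale_le] mult_mono) auto
  moreover have "norm (Complex \<gamma> \<beta> *\<^sub>c (u - v)) \<le> (\<gamma> + \<bar>\<beta>\<bar>) * norm (u - v)"
    using lam gap by (intro order_trans[OF norm_Complex_cscale_le]) auto
  moreover have "norm (Complex k \<nu> *\<^sub>c (nonlin p u - nonlin p v))
      \<le> (k + \<bar>\<nu>\<bar>) * (C * r powr p * norm (u - v))"
    using k by (intro order_trans[OF norm_Complex_cscale_le] mult_mono lip) auto
  ultimately show ?thesis unfolding field_lipschitz_def by (simp add: algebra_simps)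
qed

end

section \<open>The flow of the implicit Euler scheme\<close>

text \<open>If each implicit step has exactly one solution in \<open>B\<close>, the scheme is the iteration of the
resolvent that maps \<open>y\<close> to that solution.\<close>

lemma euler_flow_properties:
  assumes solvable: "\<forall>y\<in>B. \<exists>!u. u \<in> B \<and> u = y + \<epsilon> *\<^sub>R F u"
    and y: "y \<in> B"
  shows "euler_flow F \<epsilon> B n y \<in> B"
    and "euler_flow F \<epsilon> B 0 y = y"
    and "euler_flow F \<epsilon> B (Suc n) y = euler_flow F \<epsilon> B n y + \<epsilon> *\<^sub>R F (euler_flow F \<epsilon> B (Suc n) y)"
    and "euler_flow F \<epsilon> B (Suc n) y = euler_flow F \<epsilon> B 1 (euler_flow F \<epsilon> B n y)"
proof -
  define res where "res z = (THE u. u \<in> B \<and> u = z + \<epsilon> *\<^sub>R F u)" for z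
  have res: "res z \<in> B" "res z = z + \<epsilon> *\<^sub>R F (res z)" if "z \<in> B" for z
    using theI'[OF bspec[OF solvable that]] unfolding res_def by auto
  have res_eq: "u = res z" if "z \<in> B" "u \<in> B" "u = z + \<epsilon> *\<^sub>R F u" for u z
    using bspec[OF solvable that(1)] res[OF that(1)] that(2,3) by blast
  have in_B: "(res ^^ n) z \<in> B" if "z \<in> B" for z n
    by (induction n) (use that res in auto)
  have "euler_solution F \<epsilon> B z u \<longleftrightarrow> u = (\<lambda>n. (res ^^ n) z)" if z: "z \<in> B" for z u
  proof
    assume u: "euler_solution F \<epsilon> B z u"
    have "u n = (res ^^ n) z" for n
    proof (induction n)
      case 0
      then show ?case using u by (simp add: euler_solution_def)
    next
      case (Suc n)
      have "u (Suc n) = u n + \<epsilon> *\<^sub>R F (u (Suc n))" "u n \<in> B" "u (Suc n) \<in> B"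
        using u unfolding euler_solution_def by (metis One_nat_def diff_Suc_1 le_add1 plus_1_eq_Suc, blast, blast)
      then show ?case using res_eq Suc by simp
    qed
    then show "u = (\<lambda>n. (res ^^ n) z)" by blast
  next
    assume u: "u = (\<lambda>n. (res ^^ n) z)"
    have "u n = u (n - 1) + \<epsilon> *\<^sub>R F (u n)" if "1 \<le> n" for n
      using that res(2)[OF in_B[OF z]] by (cases n) (auto simp: u)
    then show "euler_solution F \<epsilon> B z u" using in_B[OF z] by (simp add: euler_solution_def u)
  qed
  then have flow: "euler_flow F \<epsilon> B n z = (res ^^ n) z" if "z \<in> B" for n z
    using that by (simp add: euler_flow_def)
  show "euler_flow F \<epsilon> B n y \<in> B" using flow in_B y by simp
  show "euler_flow F \<epsilon> B 0 y = y" using flow y by simp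
  show "euler_flow F \<epsilon> B (Suc n) y = euler_flow F \<epsilon> B n y + \<epsilon> *\<^sub>R F (euler_flow F \<epsilon> B (Suc n) y)"
    using flow[OF y] res(2)[OF in_B[OF y]] by simp
  show "euler_flow F \<epsilon> B (Suc n) y = euler_flow F \<epsilon> B 1 (euler_flow F \<epsilon> B n y)"
    using flow y in_B by simp
qed

context dissipative_lattice
begin

text \<open>The two terms in \<^const>\<open>eps_star\<close> serve the Banach fixed point theorem for
\<open>u \<mapsto> y + \<epsilon> F u\<close> on the ball of radius \<open>r + 1\<close>: the field bound keeps the image of the ball
within distance one of \<open>y\<close>, hence in the ball, and the Lipschitz bound makes the map a
contraction. The fixed point found in the larger ball lies in \<open>B\<close> by the energy estimate.
The contraction constant also controls how the fixed point depends on \<open>y\<close>.\<close>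

lemma implicit_step_contraction:
  assumes C: "0 < C" and lip: "\<And>r u v. 0 < r \<Longrightarrow> u \<in> cball 0 r \<Longrightarrow> v \<in> cball 0 r \<Longrightarrow>
           norm (nonlin p u - nonlin p v) \<le> C * r powr p * norm (u - v)"
    and \<eta>: "0 \<le> \<eta>" and \<epsilon>: "0 < \<epsilon>" "\<epsilon> \<le> eps_star \<eta> C lam \<mu> \<gamma> \<beta> k \<nu> p g"
  defines "B \<equiv> cball 0 (r_star \<eta> lam \<gamma> k p g)"
  shows "\<exists>c<1. 0 \<le> c \<and> (\<forall>u\<in>B. \<forall>v\<in>B. norm (\<epsilon> *\<^sub>R F u - \<epsilon> *\<^sub>R F v) \<le> c * norm (u - v))"
    and "y \<in> B \<Longrightarrow> \<exists>!u. u \<in> B \<and> u = y + \<epsilon> *\<^sub>R F u"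
proof -
  define r where "r = r_star \<eta> lam \<gamma> k p g"
  define M where "M = field_bound lam \<mu> \<gamma> \<beta> k \<nu> p g (r + 1)"
  define L where "L = field_lipschitz lam \<mu> \<gamma> \<beta> k \<nu> p C (r + 1)"
  have r: "0 \<le> r" unfolding r_def r_star_def using \<eta> c1_nonneg gap by simp
  have "0 < (4 * lam + 4 * \<bar>\<mu>\<bar> + \<gamma> + \<bar>\<beta>\<bar>) * (r + 1)" using lam gap r by (intro mult_pos_pos) auto
  moreover have "0 \<le> (k + \<bar>\<nu>\<bar>) * (r + 1) powr (p + 1)" using k by simp
  ultimately have M: "0 < M" unfolding M_def field_bound_def by (simp add: add_pos_nonneg)
  have L: "0 \<le> L" unfolding L_def field_lipschitz_def using lam gap C k by simp
  have "\<epsilon> \<le> 1 / M" "\<epsilon> \<le> 1 / (1 + L)"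
    using \<epsilon>(2) unfolding eps_star_def Let_def M_def L_def r_def by auto
  then have \<epsilon>M: "\<epsilon> * M \<le> 1" and \<epsilon>L: "\<epsilon> * L < 1"
    using M L \<epsilon>(1) by (simp_all add: field_simps)
  have contract: "norm (\<epsilon> *\<^sub>R F u - \<epsilon> *\<^sub>R F v) \<le> (\<epsilon> * L) * norm (u - v)"
    if "u \<in> cball 0 (r + 1)" "v \<in> cball 0 (r + 1)" for u v
  proof -
    have "norm (F u - F v) \<le> L * norm (u - v)"
      unfolding L_def using r that by (intro norm_F_diff_le lip) auto
    then show ?thesis using \<epsilon>(1) by (simp flip: scaleR_diff_right)
  qed
  have B: "B \<subseteq> cball 0 (r + 1)" unfolding B_def r_def by auto
  show "\<exists>c<1. 0 \<le> c \<and> (\<forall>u\<in>B. \<forall>v\<in>B. norm (\<epsilon> *\<^sub>R F u - \<epsilon> *\<^sub>R F v) \<le> c * norm (u - v))"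
    using \<epsilon>L \<epsilon>(1) L contract[OF subsetD[OF B] subsetD[OF B]]
    by (intro exI[of _ "\<epsilon> * L"]) auto
  assume y: "y \<in> B"
  have "\<exists>!u\<in>cball 0 (r + 1). y + \<epsilon> *\<^sub>R F u = u"
  proof (rule Banach_fix[where c = "\<epsilon> * L"])
    show "(\<lambda>u. y + \<epsilon> *\<^sub>R F u) ` cball 0 (r + 1) \<subseteq> cball 0 (r + 1)"
    proof clarify
      fix u :: ell2 assume "u \<in> cball 0 (r + 1)"
      then have "norm (F u) \<le> M" unfolding M_def by (intro norm_F_le) simp
      then have "\<epsilon> * norm (F u) \<le> \<epsilon> * M" using \<epsilon>(1) by (intro mult_left_mono) auto
      then have "norm (\<epsilon> *\<^sub>R F u) \<le> 1"
        unfolding norm_scaleR abs_of_pos[OF \<epsilon>(1)] using \<epsilon>M by linarith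
      moreover have "norm y \<le> r" using y by (simp add: B_def r_def)
      ultimately show "y + \<epsilon> *\<^sub>R F u \<in> cball 0 (r + 1)"
        using norm_triangle_ineq[of y "\<epsilon> *\<^sub>R F u"] by simp
    qed
    show "dist (y + \<epsilon> *\<^sub>R F u) (y + \<epsilon> *\<^sub>R F v) \<le> (\<epsilon> * L) * dist u v"
      if "u \<in> cball 0 (r + 1)" "v \<in> cball 0 (r + 1)" for u v
      using contract[OF that] by (simp add: dist_norm)
  qed (use r \<epsilon>(1) L \<epsilon>L in \<open>auto simp: complete_eq_closed\<close>)
  moreover have "u \<in> B" if "u = y + \<epsilon> *\<^sub>R F u" for u
    using euler_step_absorbing[OF \<epsilon>(1) \<eta> that] y by (simp add: B_def)
  ultimately show "\<exists>!u. u \<in> B \<and> u = y + \<epsilon> *\<^sub>R F u" using B by (metis subsetD)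
qed

end

section \<open>Cutoff weights\<close>

text \<open>Piecewise linear in \<open>\<bar>j\<bar>\<close>, rising from zero at \<open>m\<close> to one at \<open>2 m\<close> when \<open>m > 0\<close>.\<close>

definition cutoff :: "nat \<Rightarrow> int \<Rightarrow> real" where
  "cutoff m j = min 1 (max 0 (\<bar>real_of_int j\<bar> / real m - 1))"

lemma cutoff_bounds: "0 \<le> cutoff m j" "cutoff m j \<le> 1"
  by (auto simp: cutoff_def)

text \<open>The slope bound tends to zero as the cutoff moves outwards, which makes the error terms of the
weighted energy estimate negligible.\<close>

lemma cutoff_Lipschitz: "\<bar>cutoff m (j + 1) - cutoff m j\<bar> \<le> 1 / real m"
proof -
  have clip: "\<bar>min 1 (max 0 x) - min 1 (max 0 y)\<bar> \<le> \<bar>x - y\<bar>" for x y :: real by linarith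
  have "\<bar>cutoff m (j + 1) - cutoff m j\<bar> \<le>
      \<bar>(\<bar>real_of_int (j + 1)\<bar> / real m - 1) - (\<bar>real_of_int j\<bar> / real m - 1)\<bar>"
    unfolding cutoff_def by (rule clip)
  also have "\<dots> = \<bar>\<bar>real_of_int (j + 1)\<bar> - \<bar>real_of_int j\<bar>\<bar> / real m"
    by (simp add: diff_divide_distrib[symmetric])
  also have "\<dots> \<le> 1 / real m"
    by (intro divide_right_mono) auto
  finally show ?thesis .
qed

lemma cutoff_eq_0:
  assumes "\<bar>j\<bar> \<le> int m" shows "cutoff m j = 0"
proof -
  have "\<bar>real_of_int j\<bar> \<le> real m" using assms by linarith
  then have "\<bar>real_of_int j\<bar> / real m \<le> 1" by (cases "m = 0") (simp_all add: divide_le_eq_1)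
  then show ?thesis by (simp add: cutoff_def)
qed

lemma cutoff_eq_1:
  assumes "0 < m" "2 * int m \<le> \<bar>j\<bar>" shows "cutoff m j = 1"
proof -
  have "real_of_int (2 * int m) \<le> real_of_int \<bar>j\<bar>" using assms(2) by (rule of_int_le_iff[THEN iffD2])
  then have "2 \<le> \<bar>real_of_int j\<bar> / real m" using assms(1) by (simp add: field_simps)
  then show ?thesis by (simp add: cutoff_def)
qed

lemma cutoff_mult_summable:
  assumes "f summable_on UNIV" "\<And>j. 0 \<le> f j"
  shows "(\<lambda>j. cutoff m j * f j :: real) summable_on UNIV"
  by (rule summable_on_comparison_test[OF assms(1)])
     (use assms(2) cutoff_bounds in \<open>auto intro: mult_left_le_one_le\<close>)

text \<open>For large \<open>m\<close> the cutoff vanishes on a finite set carrying all but \<open>e / 2\<close> of the sum.\<close>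

lemma cutoff_sum_tendsto_0:
  fixes f :: "int \<Rightarrow> real"
  assumes f: "f summable_on UNIV" "\<And>j. 0 \<le> f j"
  shows "(\<lambda>m. \<Sum>\<^sub>\<infinity>j. cutoff m j * f j) \<longlonglongrightarrow> 0"
proof (rule LIMSEQ_I)
  fix e :: real assume "0 < e"
  then obtain J where J: "finite J" "dist (sum f J) (infsum f UNIV) \<le> e / 2"
    using infsum_finite_approximation[OF f(1), of "e / 2"] by auto
  obtain m0 where m0: "\<And>j. j \<in> J \<Longrightarrow> \<bar>j\<bar> \<le> int m0"
  proof
    fix j assume "j \<in> J"
    then have "nat \<bar>j\<bar> \<le> Max ((\<lambda>j. nat \<bar>j\<bar>) ` J)" using J(1) by (intro Max_ge) auto
    then show "\<bar>j\<bar> \<le> int (Max ((\<lambda>j. nat \<bar>j\<bar>) ` J))" by linarith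
  qed
  have "norm ((\<Sum>\<^sub>\<infinity>j. cutoff m j * f j) - 0) < e" if "m0 \<le> m" for m
  proof -
    have "((\<lambda>j. if j \<in> J then f j else 0) has_sum sum f J) UNIV"
      using has_sum_cong_neutral[of J UNIV f "\<lambda>j. if j \<in> J then f j else 0" "sum f J"]
        has_sum_finite[OF J(1), of f] by auto
    from has_sum_add[OF has_sum_infsum[OF f(1)] has_sum_cmult_right[OF this, of "-1"]]
    have rest: "((\<lambda>j. f j - (if j \<in> J then f j else 0)) has_sum (infsum f UNIV - sum f J)) UNIV"
      by simp
    have cut: "((\<lambda>j. cutoff m j * f j) has_sum (\<Sum>\<^sub>\<infinity>j. cutoff m j * f j)) UNIV"
      by (intro has_sum_infsum cutoff_mult_summable f)
    have "cutoff m j * f j \<le> f j - (if j \<in> J then f j else 0)" for j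
    proof (cases "j \<in> J")
      case True
      then show ?thesis using m0[of j] that by (simp add: cutoff_eq_0)
    next
      case False
      then show ?thesis using cutoff_bounds f(2) by (simp add: mult_left_le_one_le)
    qed
    then have "(\<Sum>\<^sub>\<infinity>j. cutoff m j * f j) \<le> infsum f UNIV - sum f J"
      by (rule has_sum_mono[OF cut rest])
    moreover have "0 \<le> (\<Sum>\<^sub>\<infinity>j. cutoff m j * f j)"
      by (intro infsum_nonneg mult_nonneg_nonneg cutoff_bounds f)
    ultimately show ?thesis using J(2) \<open>0 < e\<close> by (simp add: dist_real_def)
  qed
  then show "\<exists>N. \<forall>m\<ge>N. norm ((\<Sum>\<^sub>\<infinity>j. cutoff m j * f j) - 0) < e" by blast
qed

section \<open>Uniform smallness of the tails\<close>

text \<open>The value \<open>d\<close> is the fixed point of the recursion and the deviation from it contracts by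
the factor \<open>1 / (1 + a)\<close>.\<close>

lemma affine_recursion_bound:
  fixes E :: "nat \<Rightarrow> real"
  assumes "0 < a" and rec: "\<And>n. (1 + a) * E (Suc n) \<le> E n + a * d" and "0 \<le> d"
  shows "E n \<le> (1 / (1 + a)) ^ n * E 0 + d"
proof (induction n)
  case 0
  then show ?case using \<open>0 \<le> d\<close> by simp
next
  case (Suc n)
  have "E (Suc n) \<le> (1 / (1 + a)) * (E n + a * d)"
    using rec[of n] \<open>0 < a\<close> by (simp add: field_simps)
  also have "\<dots> \<le> (1 / (1 + a)) * (((1 / (1 + a)) ^ n * E 0 + d) + a * d)"
    using Suc \<open>0 < a\<close> by (intro mult_left_mono) auto
  also have "\<dots> = (1 / (1 + a)) ^ Suc n * E 0 + (1 / (1 + a)) * ((1 + a) * d)"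
    unfolding power_Suc by algebra
  also have "\<dots> = (1 / (1 + a)) ^ Suc n * E 0 + d"
    using \<open>0 < a\<close> by simp
  finally show ?case .
qed

context dissipative_lattice
begin

text \<open>The energy weighted by the cutoff obeys the recursion \<open>(1 + a) E\<^sub>n\<^sub>+\<^sub>1 \<le> E\<^sub>n + a d\<close>,
where \<open>d\<close> collects the forcing beyond the cutoff and the cutoff gradient. The cutoff is chosen
first, to make \<open>d\<close> small, and then the time after which the initial energy, at most
\<open>r\<^sup>2\<close> for every trajectory, has decayed. Both choices are the same for all trajectories in
the ball.\<close>

lemma uniformly_small_tails:
  assumes \<epsilon>: "0 < \<epsilon>" and e: "0 < e"
  shows "\<exists>J N. finite J \<and> (\<forall>u. (\<forall>n. norm (u n) \<le> r) \<and> (\<forall>n. u (Suc n) = u n + \<epsilon> *\<^sub>R F (u (Suc n))) \<longrightarrow>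
      (\<forall>n\<ge>N. (\<Sum>\<^sub>\<infinity>j\<in>-J. (cmod (coord (u n) j))\<^sup>2) \<le> e))"
proof -
  define a where "a = 2 * \<epsilon> * (\<gamma> - 4 * lam)"
  have a: "0 < a" using gap \<epsilon> by (simp add: a_def)
  define d where "d m = (forcing_weight * (\<Sum>\<^sub>\<infinity>j. cutoff m j * g_pow j)
    + 1 / real m * (lam + \<bar>\<mu>\<bar>) * r\<^sup>2) / (\<gamma> - 4 * lam)" for m
  have "d \<longlonglongrightarrow> (forcing_weight * 0 + 0 * (lam + \<bar>\<mu>\<bar>) * r\<^sup>2) / (\<gamma> - 4 * lam)"
    unfolding d_def using gap
    by (intro tendsto_intros cutoff_sum_tendsto_0 g_pow_summable lim_1_over_n) auto
  then have "eventually (\<lambda>m. d m < e / 2) sequentially"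
    using e by (intro order_tendstoD(2)) auto
  then obtain m where m: "0 < m" "d m < e / 2"
    unfolding eventually_sequentially by (metis le_add1 zero_less_Suc le_Suc_eq le_refl)
  have d0: "0 \<le> d m" unfolding d_def using gap k p lam
    by (intro divide_nonneg_nonneg add_nonneg_nonneg mult_nonneg_nonneg infsum_nonneg cutoff_bounds) auto
  have "(\<lambda>n. (1 / (1 + a)) ^ n * r\<^sup>2) \<longlonglongrightarrow> 0 * r\<^sup>2"
    using a by (intro tendsto_mult LIMSEQ_power_zero tendsto_const) auto
  then have "eventually (\<lambda>n. (1 / (1 + a)) ^ n * r\<^sup>2 < e / 2) sequentially"
    using e by (intro order_tendstoD(2)) auto
  then obtain N where N: "\<And>n. n \<ge> N \<Longrightarrow> (1 / (1 + a)) ^ n * r\<^sup>2 < e / 2"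
    unfolding eventually_sequentially by blast
  show ?thesis
  proof (intro exI[of _ "{- 2 * int m .. 2 * int m}"] exI[of _ N] conjI allI impI)
    fix u :: "nat \<Rightarrow> ell2" and n
    assume u: "(\<forall>n. norm (u n) \<le> r) \<and> (\<forall>n. u (Suc n) = u n + \<epsilon> *\<^sub>R F (u (Suc n)))" and n: "n \<ge> N"
    have r: "norm (u n) \<le> r" and step: "u (Suc n) = u n + \<epsilon> *\<^sub>R F (u (Suc n))" for n
      using u by blast+
    define E where "E n = (\<Sum>\<^sub>\<infinity>j. cutoff m j * (cmod (coord (u n) j))\<^sup>2)" for n
    have summ: "(\<lambda>j. cutoff m j * (cmod (coord (u n) j))\<^sup>2) summable_on UNIV" for n
      by (intro cutoff_mult_summable square_summable_coord) auto
    have "(1 + a) * E (Suc n) \<le> E n + a * d m" for n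
    proof -
      have "(1 + a) * E (Suc n) \<le> E n + 2 * \<epsilon> * (forcing_weight * (\<Sum>\<^sub>\<infinity>j. cutoff m j * g_pow j)
          + 1 / real m * (lam + \<bar>\<mu>\<bar>) * (norm (u (Suc n)))\<^sup>2)"
        unfolding a_def E_def
        by (intro weighted_energy_step cutoff_bounds cutoff_Lipschitz \<epsilon> step)
      also have "\<dots> \<le> E n + 2 * \<epsilon> * (forcing_weight * (\<Sum>\<^sub>\<infinity>j. cutoff m j * g_pow j)
          + 1 / real m * (lam + \<bar>\<mu>\<bar>) * r\<^sup>2)"
        using \<epsilon> lam r by (intro add_left_mono mult_left_mono power_mono) auto
      also have "\<dots> = E n + a * d m" unfolding a_def d_def using gap by simp
      finally show ?thesis .
    qed
    then have "E n \<le> (1 / (1 + a)) ^ n * E 0 + d m"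
      using a d0 by (intro affine_recursion_bound)
    also have "\<dots> \<le> (1 / (1 + a)) ^ n * r\<^sup>2 + d m"
    proof -
      have "E 0 \<le> (\<Sum>\<^sub>\<infinity>j. (cmod (coord (u 0) j))\<^sup>2)"
        unfolding E_def
        by (intro infsum_mono summ square_summable_coord mult_left_le_one_le cutoff_bounds) auto
      also have "\<dots> \<le> r\<^sup>2" unfolding norm_ell2_sq[symmetric] using r by (intro power_mono) auto
      finally show ?thesis using a by (intro add_right_mono mult_left_mono) auto
    qed
    also have "\<dots> \<le> e" using N[OF n] m(2) by linarith
    finally have "E n \<le> e" .
    moreover have "(\<Sum>\<^sub>\<infinity>j\<in>- {- 2 * int m .. 2 * int m}. (cmod (coord (u n) j))\<^sup>2) \<le> E n"
      unfolding E_def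
    proof (rule infsum_mono_neutral[OF square_summable_coord summ])
      fix j assume "j \<in> - {- 2 * int m .. 2 * int m} \<inter> UNIV"
      then have "2 * int m \<le> \<bar>j\<bar>" by auto
      then show "(cmod (coord (u n) j))\<^sup>2 \<le> cutoff m j * (cmod (coord (u n) j))\<^sup>2"
        using cutoff_eq_1[OF m(1)] by simp
    qed (auto simp: cutoff_bounds)
    ultimately show "(\<Sum>\<^sub>\<infinity>j\<in>- {- 2 * int m .. 2 * int m}. (cmod (coord (u n) j))\<^sup>2) \<le> e"
      by linarith
  qed simp
qed

end

section \<open>Existence and uniqueness of the attractor\<close>

theorem theorem3p2:
  fixes lam \<mu> \<gamma> \<beta> k \<nu> p \<eta> C \<epsilon> :: real
    and g :: "int \<Rightarrow> complex"
  assumes "0 < lam" and "0 < \<gamma>" and "0 < k" and "0 < p" and "4 * lam < \<gamma>" and "0 \<le> \<eta>"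
    and "lq_summable ((p + 2) / (p + 1)) g"
    and "0 < C"
    and "\<And>r u v. 0 < r \<Longrightarrow> u \<in> cball 0 r \<Longrightarrow> v \<in> cball 0 r \<Longrightarrow>
           norm (nonlin p u - nonlin p v) \<le> C * r powr p * norm (u - v)"
    and "0 < \<epsilon>" and "\<epsilon> \<le> eps_star \<eta> C lam \<mu> \<gamma> \<beta> k \<nu> p g"
  shows "let B = cball 0 (r_star \<eta> lam \<gamma> k p g);
             S = euler_flow (vector_field lam \<mu> \<gamma> \<beta> k \<nu> p g) \<epsilon> B
         in (\<exists>!A. numerical_attractor S B A) \<and>
            numerical_attractor S B (\<Inter>m. closure (\<Union>n\<in>{m..}. S n ` B))"
proof -
  interpret dissipative_lattice lam \<mu> \<gamma> \<beta> k \<nu> p g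
    using assms by unfold_locales
  define r where "r = r_star \<eta> lam \<gamma> k p g"
  define B where "B = cball (0::ell2) r"
  define S where "S = euler_flow F \<epsilon> B"
  have contract: "\<exists>c<1. 0 \<le> c \<and>
      (\<forall>u\<in>B. \<forall>v\<in>B. norm (\<epsilon> *\<^sub>R F u - \<epsilon> *\<^sub>R F v) \<le> c * norm (u - v))"
    and solvable: "\<forall>y\<in>B. \<exists>!u. u \<in> B \<and> u = y + \<epsilon> *\<^sub>R F u"
    using implicit_step_contraction[OF assms(8,9,6,10,11)] by (simp_all add: B_def r_def)
  note S = euler_flow_properties[OF solvable, folded S_def]
  \<comment> \<open>Subtracting two implicit steps and absorbing the contractive term makes one step Lipschitz.\<close>
  have cont: "continuous_on B (S 1)"
  proof -
    obtain c where c: "c < 1" "0 \<le> c"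
      "\<And>u v. u \<in> B \<Longrightarrow> v \<in> B \<Longrightarrow> norm (\<epsilon> *\<^sub>R F u - \<epsilon> *\<^sub>R F v) \<le> c * norm (u - v)"
      using contract by blast
    have "norm (S 1 y - S 1 z) \<le> 1 / (1 - c) * norm (y - z)" if "y \<in> B" "z \<in> B" for y z
    proof -
      have step: "S 1 x = x + \<epsilon> *\<^sub>R F (S 1 x)" if "x \<in> B" for x
        using S(3)[OF that, of 0] S(2)[OF that] by simp
      have "S 1 y - S 1 z = (y - z) + (\<epsilon> *\<^sub>R F (S 1 y) - \<epsilon> *\<^sub>R F (S 1 z))"
        using step[OF that(1)] step[OF that(2)] by (metis add_diff_add)
      then have "norm (S 1 y - S 1 z) \<le> norm (y - z) + c * norm (S 1 y - S 1 z)"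
        using norm_triangle_ineq[of "y - z" "\<epsilon> *\<^sub>R F (S 1 y) - \<epsilon> *\<^sub>R F (S 1 z)"]
          c(3)[OF S(1)[OF that(1)] S(1)[OF that(2)], of 1 1] by simp
      then show ?thesis using c(1) by (simp add: field_simps)
    qed
    then have "(1 / (1 - c))-lipschitz_on B (S 1)"
      using c by (intro lipschitz_onI) (auto simp: dist_norm)
    then show ?thesis by (rule lipschitz_on_continuous_on)
  qed
  have compact: "\<exists>l s. strict_mono s \<and> (\<lambda>i. S (n (s i)) (y (s i))) \<longlonglongrightarrow> l"
    if n: "filterlim n at_top sequentially" and y: "\<And>i::nat. y i \<in> B" for n y
  proof -
    have "norm (S (n i) (y i)) \<le> r" for i using S(1)[OF y] by (simp add: B_def)
    moreover have "\<exists>J. finite J \<and>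
        eventually (\<lambda>i. (\<Sum>\<^sub>\<infinity>j\<in>-J. (cmod (coord (S (n i) (y i)) j))\<^sup>2) \<le> e) sequentially"
      if "0 < e" for e
    proof -
      obtain J N where J: "finite J"
        and N: "\<forall>u. (\<forall>n. norm (u n) \<le> r) \<and> (\<forall>n. u (Suc n) = u n + \<epsilon> *\<^sub>R F (u (Suc n))) \<longrightarrow>
          (\<forall>n\<ge>N. (\<Sum>\<^sub>\<infinity>j\<in>-J. (cmod (coord (u n) j))\<^sup>2) \<le> e)"
        using uniformly_small_tails[OF assms(10) \<open>0 < e\<close>, of r] by blast
      have "eventually (\<lambda>i. N \<le> n i) sequentially" using n by (simp add: filterlim_at_top)
      then have "eventually (\<lambda>i. (\<Sum>\<^sub>\<infinity>j\<in>-J. (cmod (coord (S (n i) (y i)) j))\<^sup>2) \<le> e) sequentially"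
      proof (rule eventually_mono)
        fix i assume i: "N \<le> n i"
        show "(\<Sum>\<^sub>\<infinity>j\<in>-J. (cmod (coord (S (n i) (y i)) j))\<^sup>2) \<le> e"
        proof (rule N[THEN spec[of _ "\<lambda>n. S n (y i)"], THEN mp, THEN spec, THEN mp, OF _ i], intro conjI allI)
          show "norm (S n (y i)) \<le> r" for n using S(1)[OF y] by (simp add: B_def)
          show "S (Suc n) (y i) = S n (y i) + \<epsilon> *\<^sub>R F (S (Suc n) (y i))" for n
            by (rule S(3)[OF y])
        qed
      qed
      then show ?thesis using J by blast
    qed
    ultimately show ?thesis
      by (rule small_tails_convergent_subseq[of "\<lambda>i. S (n i) (y i)" r]) blast+
  qed
  have B: "closed B" by (simp add: B_def)
  have "numerical_attractor S B (\<Inter>m. closure (\<Union>n\<in>{m..}. S n ` B))"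
    by (rule omega_limit_numerical_attractor(1)[OF B])
       (erule S(1), erule S(2), erule S(4), rule cont, rule compact, simp_all)
  moreover have "A = (\<Inter>m. closure (\<Union>n\<in>{m..}. S n ` B))" if "numerical_attractor S B A" for A
    by (rule omega_limit_numerical_attractor(2)[OF B])
       (erule S(1), erule S(2), erule S(4), rule cont, rule compact, simp_all add: that)
  ultimately have "(\<exists>!A. numerical_attractor S B A) \<and>
            numerical_attractor S B (\<Inter>m. closure (\<Union>n\<in>{m..}. S n ` B))"
    by blast
  then show ?thesis unfolding Let_def S_def B_def r_def .
qed

end
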